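(* Let $n\ge 1$. With the operators $T_i, E_i \in \operatorname{End}_K(V^{\otimes n})$ ($1\le i\le n-1$) defined in the context, the tensor space $V^{\otimes n}$ becomes a module for the algebra $\mathcal{E}_n(u)$, the generators $T_i$ and $E_i$ of $\mathcal{E}_n(u)$ acting by the operators of the same name.
   Context: Let $u$ be an indeterminate, $\mathcal{A}=\mathbb{C}[u,u^{-1}]$ and $K=\mathbb{C}(u)$. $\mathcal{E}^{\mathcal{A}}_n(u)$ is the associative unital $\mathcal{A}$-algebra on generators $T_1,\dots,T_{n-1}$, $E_1,\dots,E_{n-1}$ with relations: (E1) $T_iT_j=T_jT_i$ if $|i-j|>1$; (E2) $E_iE_j=E_jE_i$ for all $i,j$; (E3) $E_iT_j=T_jE_i$ if $|i-j|>1$; (E4) $E_i^2=E_i$; (E5) $E_iT_i=T_iE_i$; (E6) $T_iT_jT_i=T_jT_iT_j$ if $|i-j|=1$; (E7) $E_jT_iT_j=T_iT_jE_i$ if $|i-j|=1$; (E8) $E_iE_jT_j=E_iT_jE_i=T_jE_iE_j$ if $|i-j|=1$; (E9) $T_i^2=1+(u-1)E_i(1+T_i)$. Put $\mathcal{E}_n(u)=\mathcal{E}^{\mathcal{A}}_n(u)\otimes_{\mathcal{A}}K$. Tensor space: $V$ is the $K$-vector space with basis $\{v_i^j \mid i,j=1,\dots,n\}$ ($i$ is the lower index, $j$ the upper index, not a power). Define $E,T\in\operatorname{End}_K(V^{\otimes 2})$ by $E(v_{i_1}^{j_1}\otimes v_{i_2}^{j_2})=v_{i_1}^{j_1}\otimes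 v_{i_2}^{j_2}$ if $j_1=j_2$, and $0$ otherwise; and $T(v_{i_1}^{j_1}\otimes v_{i_2}^{j_2})=$ - $v_{i_2}^{j_2}\otimes v_{i_1}^{j_1}$ if $j_1\ne j_2$; - $u\,v_{i_2}^{j_1}\otimes v_{i_1}^{j_2}$ if $j_1=j_2$, $i_1=i_2$; - $v_{i_2}^{j_2}\otimes v_{i_1}^{j_1}$ if $j_1=j_2$, $i_1<i_2$; - $u\,v_{i_2}^{j_2}\otimes v_{i_1}^{j_1}+(u-1)\,v_{i_1}^{j_1}\otimes v_{i_2}^{j_2}$ if $j_1=j_2$, $i_1>i_2$. The operators $E_i,T_i$ on $V^{\otimes n}$ are obtained by letting $E$, respectively $T$, act in the tensor factors $(i,i+1)$ and the identity elsewhere. *)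

theory Defs
  imports
    "HOL-Library.Poly_Mapping"
    "HOL-Computational_Algebra.Polynomial"
    "HOL-Computational_Algebra.Fraction_Field"
    "HOL-Algebra.QuotRing"
    "HOL-Algebra.Generated_Groups"
    "HOL-Algebra.Module"
begin

section \<open>The coefficient rings\<close>

type_synonym ratfun = "complex poly fract"

definition indet :: ratfun
  where "indet = Fract [:0, 1:] 1"

definition ratfun_field :: "ratfun ring"
  where "ratfun_field = \<lparr>carrier = UNIV, mult = (*), one = 1, zero = 0, add = (+)\<rparr>"

text \<open>Laurent polynomials are realised as the fractions whose denominator is a power of the
  indeterminate, so the structure map into the rational functions is the inclusion.\<close>

definition laurent_polys :: "ratfun set"
  where "laurent_polys = {Fract p (monom 1 k) | p k. True}"


section \<open>Monoid rings and tensor products of algebras\<close>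

text \<open>Finitely supported functions with convolution. The coefficients range over a subring
  \<open>S\<close> of a ring given as a type, the exponents over a monoid with explicit carrier.\<close>

definition conv ::
    "('m \<Rightarrow> 'm \<Rightarrow> 'm) \<Rightarrow> ('m \<Rightarrow>\<^sub>0 'r) \<Rightarrow> ('m \<Rightarrow>\<^sub>0 'r) \<Rightarrow> ('m \<Rightarrow>\<^sub>0 'r::comm_ring_1)"
  where "conv f x y = (\<Sum>a\<in>Poly_Mapping.keys x. \<Sum>b\<in>Poly_Mapping.keys y.
    Poly_Mapping.single (f a b) (Poly_Mapping.lookup x a * Poly_Mapping.lookup y b))"

definition monoid_ring :: "'r::comm_ring_1 set \<Rightarrow> ('m, 'c) monoid_scheme \<Rightarrow> ('m \<Rightarrow>\<^sub>0 'r) ring"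
  where "monoid_ring S M =
    \<lparr>carrier = {x. Poly_Mapping.keys x \<subseteq> carrier M \<and> range (Poly_Mapping.lookup x) \<subseteq> S},
     mult = conv (mult M), one = Poly_Mapping.single \<one>\<^bsub>M\<^esub> 1, zero = 0, add = (+)\<rparr>"

definition free_monoid :: "'g set \<Rightarrow> 'g list monoid"
  where "free_monoid G = \<lparr>carrier = lists G, mult = (@), one = []\<rparr>"

text \<open>The tensor product of an algebra \<open>B\<close> with a commutative algebra \<open>C\<close> over a commutative
  ring with carrier \<open>A\<close>; an algebra over \<open>A\<close> is given by its structure map (\<open>\<beta>\<close> into the
  centre of \<open>B\<close>, \<open>\<gamma>\<close> into \<open>C\<close>).  As an additive group it is the free abelian group on the pairs
  modulo the subgroup generated by the usual bilinearity relators; the product is induced by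
  \<open>(b, c) (b', c') = (b b', c c')\<close>.\<close>

abbreviation pair_ring ::
    "('b, 'x) ring_scheme \<Rightarrow> ('c, 'y) ring_scheme \<Rightarrow> ('b \<times> 'c \<Rightarrow>\<^sub>0 int) ring"
  where "pair_ring B C \<equiv> monoid_ring UNIV (B \<times>\<times> C)"

abbreviation pair_gen :: "'b \<Rightarrow> 'c \<Rightarrow> ('b \<times> 'c \<Rightarrow>\<^sub>0 int)"
  where "pair_gen b c \<equiv> Poly_Mapping.single (b, c) 1"

definition tensor_relators :: "'a set \<Rightarrow> ('b, 'x) ring_scheme \<Rightarrow> ('a \<Rightarrow> 'b) \<Rightarrow>
    ('c, 'y) ring_scheme \<Rightarrow> ('a \<Rightarrow> 'c) \<Rightarrow> ('b \<times> 'c \<Rightarrow>\<^sub>0 int) set"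
  where "tensor_relators A B \<beta> C \<gamma> =
      {pair_gen (b \<oplus>\<^bsub>B\<^esub> b') c - (pair_gen b c + pair_gen b' c) | b b' c.
         b \<in> carrier B \<and> b' \<in> carrier B \<and> c \<in> carrier C}
    \<union> {pair_gen b (c \<oplus>\<^bsub>C\<^esub> c') - (pair_gen b c + pair_gen b c') | b c c'.
         b \<in> carrier B \<and> c \<in> carrier C \<and> c' \<in> carrier C}
    \<union> {pair_gen (\<beta> a \<otimes>\<^bsub>B\<^esub> b) c - pair_gen b (\<gamma> a \<otimes>\<^bsub>C\<^esub> c) | a b c.
         a \<in> A \<and> b \<in> carrier B \<and> c \<in> carrier C}"

definition tensor_kernel :: "'a set \<Rightarrow> ('b, 'x) ring_scheme \<Rightarrow> ('a \<Rightarrow> 'b) \<Rightarrow>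
    ('c, 'y) ring_scheme \<Rightarrow> ('a \<Rightarrow> 'c) \<Rightarrow> ('b \<times> 'c \<Rightarrow>\<^sub>0 int) set"
  where "tensor_kernel A B \<beta> C \<gamma> =
    generate (add_monoid (pair_ring B C)) (tensor_relators A B \<beta> C \<gamma>)"

definition tensor_ring :: "'a set \<Rightarrow> ('b, 'x) ring_scheme \<Rightarrow> ('a \<Rightarrow> 'b) \<Rightarrow>
    ('c, 'y) ring_scheme \<Rightarrow> ('a \<Rightarrow> 'c) \<Rightarrow> ('b \<times> 'c \<Rightarrow>\<^sub>0 int) set ring"
  where "tensor_ring A B \<beta> C \<gamma> = pair_ring B C Quot tensor_kernel A B \<beta> C \<gamma>"

definition pure_tensor :: "'a set \<Rightarrow> ('b, 'x) ring_scheme \<Rightarrow> ('a \<Rightarrow> 'b) \<Rightarrow>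
    ('c, 'y) ring_scheme \<Rightarrow> ('a \<Rightarrow> 'c) \<Rightarrow> 'b \<Rightarrow> 'c \<Rightarrow> ('b \<times> 'c \<Rightarrow>\<^sub>0 int) set"
  where "pure_tensor A B \<beta> C \<gamma> b c =
    tensor_kernel A B \<beta> C \<gamma> +>\<^bsub>pair_ring B C\<^esub> pair_gen b c"


section \<open>The algebra of braids and ties\<close>

datatype bt_gen = TGen nat | EGen nat

type_synonym bt_free = "bt_gen list \<Rightarrow>\<^sub>0 ratfun"

definition bt_free_algebra :: "nat \<Rightarrow> bt_free ring"
  where "bt_free_algebra n =
    monoid_ring laurent_polys (free_monoid (TGen ` {1..<n} \<union> EGen ` {1..<n}))"

abbreviation bt_word :: "bt_gen list \<Rightarrow> bt_free"
  where "bt_word w \<equiv> Poly_Mapping.single w 1"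

abbreviation bt_const :: "ratfun \<Rightarrow> bt_free"
  where "bt_const a \<equiv> Poly_Mapping.single [] a"

text \<open>A pair \<open>(x, y)\<close> in the following set stands for the defining relation \<open>x = y\<close>.\<close>

inductive_set bt_relations :: "nat \<Rightarrow> (bt_free \<times> bt_free) set" for n :: nat
  where
  E1: "\<lbrakk>i \<in> {1..<n}; j \<in> {1..<n}; \<bar>int i - int j\<bar> > 1\<rbrakk> \<Longrightarrow>
    (bt_word [TGen i, TGen j], bt_word [TGen j, TGen i]) \<in> bt_relations n"
| E2: "\<lbrakk>i \<in> {1..<n}; j \<in> {1..<n}\<rbrakk> \<Longrightarrow>
    (bt_word [EGen i, EGen j], bt_word [EGen j, EGen i]) \<in> bt_relations n"
| E3: "\<lbrakk>i \<in> {1..<n}; j \<in> {1..<n}; \<bar>int i - int j\<bar> > 1\<rbrakk> \<Longrightarrow>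
    (bt_word [EGen i, TGen j], bt_word [TGen j, EGen i]) \<in> bt_relations n"
| E4: "i \<in> {1..<n} \<Longrightarrow>
    (bt_word [EGen i, EGen i], bt_word [EGen i]) \<in> bt_relations n"
| E5: "i \<in> {1..<n} \<Longrightarrow>
    (bt_word [EGen i, TGen i], bt_word [TGen i, EGen i]) \<in> bt_relations n"
| E6: "\<lbrakk>i \<in> {1..<n}; j \<in> {1..<n}; \<bar>int i - int j\<bar> = 1\<rbrakk> \<Longrightarrow>
    (bt_word [TGen i, TGen j, TGen i], bt_word [TGen j, TGen i, TGen j]) \<in> bt_relations n"
| E7: "\<lbrakk>i \<in> {1..<n}; j \<in> {1..<n}; \<bar>int i - int j\<bar> = 1\<rbrakk> \<Longrightarrow>
    (bt_word [EGen j, TGen i, TGen j], bt_word [TGen i, TGen j, EGen i]) \<in> bt_relations n"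
| E8a: "\<lbrakk>i \<in> {1..<n}; j \<in> {1..<n}; \<bar>int i - int j\<bar> = 1\<rbrakk> \<Longrightarrow>
    (bt_word [EGen i, EGen j, TGen j], bt_word [EGen i, TGen j, EGen i]) \<in> bt_relations n"
| E8b: "\<lbrakk>i \<in> {1..<n}; j \<in> {1..<n}; \<bar>int i - int j\<bar> = 1\<rbrakk> \<Longrightarrow>
    (bt_word [EGen i, TGen j, EGen i], bt_word [TGen j, EGen i, EGen j]) \<in> bt_relations n"
| E9: "i \<in> {1..<n} \<Longrightarrow>
    (bt_word [TGen i, TGen i],
     \<one>\<^bsub>bt_free_algebra n\<^esub> \<oplus>\<^bsub>bt_free_algebra n\<^esub>
       bt_const (indet - 1) \<otimes>\<^bsub>bt_free_algebra n\<^esub> bt_word [EGen i] \<otimes>\<^bsub>bt_free_algebra n\<^esub>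
         (\<one>\<^bsub>bt_free_algebra n\<^esub> \<oplus>\<^bsub>bt_free_algebra n\<^esub> bt_word [TGen i])) \<in> bt_relations n"

definition bt_ideal :: "nat \<Rightarrow> bt_free set"
  where "bt_ideal n = Idl\<^bsub>bt_free_algebra n\<^esub>
    {x \<ominus>\<^bsub>bt_free_algebra n\<^esub> y | x y. (x, y) \<in> bt_relations n}"

text \<open>The integral form over the Laurent polynomials, and the class map from the free algebra.\<close>

definition bt_integral :: "nat \<Rightarrow> bt_free set ring"
  where "bt_integral n = bt_free_algebra n Quot bt_ideal n"

definition bt_class :: "nat \<Rightarrow> bt_free \<Rightarrow> bt_free set"
  where "bt_class n x = bt_ideal n +>\<^bsub>bt_free_algebra n\<^esub> x"

definition bt_integral_scalar :: "nat \<Rightarrow> ratfun \<Rightarrow> bt_free set"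
  where "bt_integral_scalar n a = bt_class n (bt_const a)"

type_synonym bt_elem = "(bt_free set \<times> ratfun \<Rightarrow>\<^sub>0 int) set"

definition bt_algebra :: "nat \<Rightarrow> bt_elem ring"
  where "bt_algebra n =
    tensor_ring laurent_polys (bt_integral n) (bt_integral_scalar n) ratfun_field (\<lambda>a. a)"

definition bt_tensor :: "nat \<Rightarrow> bt_free set \<Rightarrow> ratfun \<Rightarrow> bt_elem"
  where "bt_tensor n =
    pure_tensor laurent_polys (bt_integral n) (bt_integral_scalar n) ratfun_field (\<lambda>a. a)"

definition bt_scalar :: "nat \<Rightarrow> ratfun \<Rightarrow> bt_elem"
  where "bt_scalar n k = bt_tensor n \<one>\<^bsub>bt_integral n\<^esub> k"

definition bt_T :: "nat \<Rightarrow> nat \<Rightarrow> bt_elem"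
  where "bt_T n i = bt_tensor n (bt_class n (bt_word [TGen i])) 1"

definition bt_E :: "nat \<Rightarrow> nat \<Rightarrow> bt_elem"
  where "bt_E n i = bt_tensor n (bt_class n (bt_word [EGen i])) 1"


section \<open>Modules over an associative algebra\<close>

text \<open>\<open>R\<close> is an associative unital algebra over \<open>K\<close> with structure map \<open>\<eta>\<close>, and \<open>act\<close> makes
  the \<open>K\<close>-module \<open>M\<close> a left \<open>R\<close>-module; the last axiom says that the two actions of
  \<open>K\<close> on \<open>M\<close> agree.\<close>

locale algebra_module =
  K?: cring K + R?: ring R + M?: module K M
  for K :: "('k, 'x) ring_scheme" (structure)
    and R :: "('r, 'y) ring_scheme" (structure)
    and \<eta> :: "'k \<Rightarrow> 'r"
    and M :: "('k, 'v, 'z) module_scheme" (structure)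
    and act :: "'r \<Rightarrow> 'v \<Rightarrow> 'v" +
  assumes scalar_hom: "\<eta> \<in> ring_hom K R"
    and scalar_central:
      "\<lbrakk>k \<in> carrier K; a \<in> carrier R\<rbrakk> \<Longrightarrow> \<eta> k \<otimes>\<^bsub>R\<^esub> a = a \<otimes>\<^bsub>R\<^esub> \<eta> k"
    and act_closed: "\<lbrakk>a \<in> carrier R; x \<in> carrier M\<rbrakk> \<Longrightarrow> act a x \<in> carrier M"
    and act_add_left: "\<lbrakk>a \<in> carrier R; b \<in> carrier R; x \<in> carrier M\<rbrakk> \<Longrightarrow>
      act (a \<oplus>\<^bsub>R\<^esub> b) x = act a x \<oplus>\<^bsub>M\<^esub> act b x"
    and act_add_right: "\<lbrakk>a \<in> carrier R; x \<in> carrier M; y \<in> carrier M\<rbrakk> \<Longrightarrow>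
      act a (x \<oplus>\<^bsub>M\<^esub> y) = act a x \<oplus>\<^bsub>M\<^esub> act a y"
    and act_mult: "\<lbrakk>a \<in> carrier R; b \<in> carrier R; x \<in> carrier M\<rbrakk> \<Longrightarrow>
      act (a \<otimes>\<^bsub>R\<^esub> b) x = act a (act b x)"
    and act_one: "x \<in> carrier M \<Longrightarrow> act \<one>\<^bsub>R\<^esub> x = x"
    and act_scalar: "\<lbrakk>k \<in> carrier K; x \<in> carrier M\<rbrakk> \<Longrightarrow> act (\<eta> k) x = k \<odot>\<^bsub>M\<^esub> x"


section \<open>Tensor space\<close>

definition scale :: "'k::comm_ring_1 \<Rightarrow> ('a \<Rightarrow>\<^sub>0 'k) \<Rightarrow> ('a \<Rightarrow>\<^sub>0 'k)"
  where "scale c x = Poly_Mapping.map ((*) c) x"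

definition lin_ext :: "('a \<Rightarrow> ('b \<Rightarrow>\<^sub>0 'k)) \<Rightarrow> ('a \<Rightarrow>\<^sub>0 'k) \<Rightarrow> ('b \<Rightarrow>\<^sub>0 'k::comm_ring_1)"
  where "lin_ext f x = (\<Sum>a\<in>Poly_Mapping.keys x. scale (Poly_Mapping.lookup x a) (f a))"

text \<open>The pair \<open>(i, j)\<close> stands for the basis vector of \<open>V\<close> with lower index \<open>i\<close> and upper index
  \<open>j\<close>. A list of \<open>n\<close> such pairs stands for the tensor product of the corresponding basis
  vectors, and the \<open>n\<close>-th tensor power of \<open>V\<close> is the space with these lists as basis.\<close>

type_synonym idx = "nat \<times> nat"

definition tensor_space :: "nat \<Rightarrow> (ratfun, idx list \<Rightarrow>\<^sub>0 ratfun) module"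
  where "tensor_space n =
    \<lparr>carrier = {x. Poly_Mapping.keys x \<subseteq> {w \<in> lists ({1..n} \<times> {1..n}). length w = n}},
     mult = undefined, one = undefined, zero = 0, add = (+), smult = scale\<rparr>"

abbreviation vv :: "idx \<Rightarrow> idx \<Rightarrow> (idx \<times> idx \<Rightarrow>\<^sub>0 ratfun)"  (infix \<open>\<otimes>\<^sub>V\<close> 75)
  where "p \<otimes>\<^sub>V q \<equiv> Poly_Mapping.single (p, q) 1"

definition E_op :: "(idx \<times> idx \<Rightarrow>\<^sub>0 ratfun) \<Rightarrow> (idx \<times> idx \<Rightarrow>\<^sub>0 ratfun)"
  where "E_op = lin_ext (\<lambda>((i1, j1), (i2, j2)).
    if j1 = j2 then (i1, j1) \<otimes>\<^sub>V (i2, j2) else 0)"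

definition T_op :: "(idx \<times> idx \<Rightarrow>\<^sub>0 ratfun) \<Rightarrow> (idx \<times> idx \<Rightarrow>\<^sub>0 ratfun)"
  where "T_op = lin_ext (\<lambda>((i1, j1), (i2, j2)).
    if j1 \<noteq> j2 then (i2, j2) \<otimes>\<^sub>V (i1, j1)
    else if i1 = i2 then scale indet ((i2, j1) \<otimes>\<^sub>V (i1, j2))
    else if i1 < i2 then (i2, j2) \<otimes>\<^sub>V (i1, j1)
    else scale indet ((i2, j2) \<otimes>\<^sub>V (i1, j1)) + scale (indet - 1) ((i1, j1) \<otimes>\<^sub>V (i2, j2)))"

text \<open>An endomorphism \<open>F\<close> of the tensor square acting in the factors \<open>i\<close> and \<open>i + 1\<close>, which sit at
  the list positions \<open>i - 1\<close> and \<open>i\<close>.\<close>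

definition act_at :: "nat \<Rightarrow> ((idx \<times> idx \<Rightarrow>\<^sub>0 ratfun) \<Rightarrow> (idx \<times> idx \<Rightarrow>\<^sub>0 ratfun)) \<Rightarrow>
    (idx list \<Rightarrow>\<^sub>0 ratfun) \<Rightarrow> (idx list \<Rightarrow>\<^sub>0 ratfun)"
  where "act_at i F = lin_ext (\<lambda>w.
    lin_ext (\<lambda>(p, q). Poly_Mapping.single (w[i - 1 := p, i := q]) 1)
      (F ((w ! (i - 1)) \<otimes>\<^sub>V (w ! i))))"

end

theory Submission
  imports Defs
begin

text \<open>The algebra is reached from the free algebra in two steps, the quotient by the defining relations
  and the extension of scalars to the rational functions, and the action on tensor space is built along the same
  steps.

  Words in the generators act on tensor space by composing the operators of their letters, and with Laurent
  polynomials as coefficients this makes the free algebra act (\<open>linear_monoid_action.ring_action_ext\<close>). The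
  elements that act as zero form a two-sided ideal (\<open>ring_action.annihilator_ideal\<close>). Hence the ideal generated
  by the defining relations acts as zero once each relation holds for the operators, and the
  quotient acts (\<open>ring_action.quotient_ring_action\<close>). This action commutes with multiplication by
  rational functions and agrees with it on Laurent polynomials, so that the tensor product of the
  two rings acts: \<open>b \<otimes> c\<close> as \<open>b\<close> followed by multiplication by \<open>c\<close>
  (\<open>compatible_actions.tensor_ring_action\<close>). The tensor product being a quotient of formal sums
  of pairs, this is the same pattern of a monoid ring, an ideal and its annihilation once more.

  What remains is to check the relations on basis vectors (\<open>relation_act\<close>). Generators at distant
  positions touch different tensor factors; the other relations concern two or three consecutive factors. On two
  factors \<open>T\<close> is a combination \<open>\<alpha> p q (q \<otimes> p) + \<beta> p q (p \<otimes> q)\<close>, and \<open>E\<close> is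
  diagonal. The quadratic and the braid relation become identities between the coefficients, which are
  verified by comparing the indices. The relations between \<open>E\<close> and \<open>T\<close> express that \<open>T\<close> permutes the
  upper indices as a transposition, also in the terms that leave the vectors in place, since such a term occurs
  only if the two upper indices are equal.\<close>

section \<open>Monoid rings\<close>

locale coefficient_ring =
  fixes S :: "'r::comm_ring_1 set"
  assumes zero_mem: "0 \<in> S"
    and one_mem: "1 \<in> S"
    and add_mem: "\<lbrakk>c \<in> S; d \<in> S\<rbrakk> \<Longrightarrow> c + d \<in> S"
    and uminus_mem: "c \<in> S \<Longrightarrow> - c \<in> S"
    and mult_mem: "\<lbrakk>c \<in> S; d \<in> S\<rbrakk> \<Longrightarrow> c * d \<in> S"

lemma coefficient_ring_UNIV: "coefficient_ring UNIV"
  by unfold_locales auto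

text \<open>Convolution is biadditive whatever the index function \<open>f\<close> is; the monoid laws enter only through the
  values on basis elements. So the ring laws of a monoid ring follow from the lemma below by
  induction over the carrier.\<close>

lemma conv_single_single:
  "conv f (Poly_Mapping.single a c) (Poly_Mapping.single b d) = Poly_Mapping.single (f a b) (c * d)"
  by (cases "c = 0"; cases "d = 0") (simp_all add: conv_def)

lemma conv_zero_left [simp]: "conv f 0 y = 0"
  and conv_zero_right [simp]: "conv f x 0 = 0"
  by (simp_all add: conv_def)

lemma conv_add_left: "conv f (x + x') y = conv f x y + conv f x' y"
  unfolding conv_def
  by (rule setsum_keys_plus_distrib) (simp_all add: distrib_right single_add sum.distrib)

lemma conv_add_right: "conv f x (y + y') = conv f x y + conv f x y'"
proof -
  have "(\<Sum>b\<in>Poly_Mapping.keys (y + y'). Poly_Mapping.single (f a b) (c * Poly_Mapping.lookup (y + y') b))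
    = (\<Sum>b\<in>Poly_Mapping.keys y. Poly_Mapping.single (f a b) (c * Poly_Mapping.lookup y b))
      + (\<Sum>b\<in>Poly_Mapping.keys y'. Poly_Mapping.single (f a b) (c * Poly_Mapping.lookup y' b))" for a c
    by (rule setsum_keys_plus_distrib) (simp_all add: distrib_left single_add)
  then show ?thesis
    by (simp add: conv_def sum.distrib)
qed

lemma conv_minus_left: "conv f (x - x') y = conv f x y - conv f x' y"
  by (metis conv_add_left diff_add_cancel add_diff_cancel_right')

lemma conv_minus_right: "conv f x (y - y') = conv f x y - conv f x y'"
  by (metis conv_add_right diff_add_cancel add_diff_cancel_right')

locale monoid_ring_of = monoid M + coefficient_ring S
  for M :: "('m, 'c) monoid_scheme" (structure) and S :: "'r::comm_ring_1 set"
begin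

abbreviation A :: "('m \<Rightarrow>\<^sub>0 'r) ring"
  where "A \<equiv> monoid_ring S M"

lemma carrier_A: "x \<in> carrier A \<longleftrightarrow> Poly_Mapping.keys x \<subseteq> carrier M \<and> (\<forall>a. Poly_Mapping.lookup x a \<in> S)"
  by (auto simp: monoid_ring_def)

lemma single_mem: "\<lbrakk>a \<in> carrier M; c \<in> S\<rbrakk> \<Longrightarrow> Poly_Mapping.single a c \<in> carrier A"
  by (auto simp: carrier_A lookup_single when_def zero_mem split: if_splits)

lemma zero_in_A: "0 \<in> carrier A"
  by (simp add: carrier_A zero_mem)

lemma add_in_A: "\<lbrakk>x \<in> carrier A; y \<in> carrier A\<rbrakk> \<Longrightarrow> x + y \<in> carrier A"
  using keys_add[of x y] by (auto simp: carrier_A lookup_add add_mem)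

lemma uminus_in_A: "x \<in> carrier A \<Longrightarrow> - x \<in> carrier A"
  by (simp add: carrier_A uminus_mem)

text \<open>Every element is the sum of its monomials. The induction stays inside the carrier because the
  monoid laws hold only for exponents in the carrier of \<open>M\<close>.\<close>

lemma carrier_induct [consumes 1, case_names zero single add]:
  assumes x: "x \<in> carrier A"
    and zero: "P 0"
    and single: "\<And>a c. \<lbrakk>a \<in> carrier M; c \<in> S\<rbrakk> \<Longrightarrow> P (Poly_Mapping.single a c)"
    and add: "\<And>x y. \<lbrakk>x \<in> carrier A; y \<in> carrier A; P x; P y\<rbrakk> \<Longrightarrow> P (x + y)"
  shows "P x"
proof -
  have "finite F \<Longrightarrow> F \<subseteq> carrier M \<Longrightarrow>
      (\<Sum>a\<in>F. Poly_Mapping.single a (Poly_Mapping.lookup x a)) \<in> carrier A \<and>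
      P (\<Sum>a\<in>F. Poly_Mapping.single a (Poly_Mapping.lookup x a))" for F
  proof (induction F rule: finite_induct)
    case empty
    then show ?case by (simp add: zero zero_in_A)
  next
    case (insert a F)
    have "Poly_Mapping.lookup x a \<in> S" using x by (simp add: carrier_A)
    then show ?case using insert by (simp add: add single single_mem add_in_A)
  qed
  moreover have "(\<Sum>a\<in>Poly_Mapping.keys x. Poly_Mapping.single a (Poly_Mapping.lookup x a)) = x"
    by (rule poly_mapping_eqI) (simp add: lookup_sum lookup_single when_def in_keys_iff)
  ultimately show ?thesis
    using x by (metis carrier_A finite_keys)
qed

lemma mult_in_A:
  assumes "x \<in> carrier A" and "y \<in> carrier A"
  shows "conv (mult M) x y \<in> carrier A"
  using assms(1)
proof (induction rule: carrier_induct)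
  case (single a c)
  show ?case
    using assms(2)
    by (induction rule: carrier_induct)
      (simp_all add: zero_in_A conv_single_single single_mem mult_mem single add_in_A conv_add_right)
qed (simp_all add: zero_in_A add_in_A conv_add_left)

lemma conv_assoc:
  assumes "x \<in> carrier A" and "y \<in> carrier A" and "z \<in> carrier A"
  shows "conv (mult M) (conv (mult M) x y) z = conv (mult M) x (conv (mult M) y z)"
  using assms(1)
proof (induction rule: carrier_induct)
  case (single a c)
  show ?case
    using assms(2)
  proof (induction rule: carrier_induct)
    case (single b d)
    show ?case
      using assms(3)
      by (induction rule: carrier_induct)
        (simp_all add: conv_single_single conv_add_right m_assoc mult.assoc single \<open>a \<in> carrier M\<close>)
  qed (simp_all add: conv_add_left conv_add_right)
qed (simp_all add: conv_add_left)

lemma conv_one_left: "x \<in> carrier A \<Longrightarrow> conv (mult M) (Poly_Mapping.single \<one> 1) x = x"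
  by (induction rule: carrier_induct) (simp_all add: conv_single_single conv_add_right)

lemma conv_one_right: "x \<in> carrier A \<Longrightarrow> conv (mult M) x (Poly_Mapping.single \<one> 1) = x"
  by (induction rule: carrier_induct) (simp_all add: conv_single_single conv_add_left)

lemma mult_A [simp]: "x \<otimes>\<^bsub>A\<^esub> y = conv (mult M) x y"
  and one_A [simp]: "\<one>\<^bsub>A\<^esub> = Poly_Mapping.single \<one> 1"
  and zero_A [simp]: "\<zero>\<^bsub>A\<^esub> = 0"
  and add_A [simp]: "x \<oplus>\<^bsub>A\<^esub> y = x + y"
  by (simp_all add: monoid_ring_def)

sublocale ring: ring A
proof (rule ringI)
  show "abelian_group A"
  proof (rule abelian_groupI)
    fix x assume "x \<in> carrier A"
    then show "\<exists>y\<in>carrier A. y \<oplus>\<^bsub>A\<^esub> x = \<zero>\<^bsub>A\<^esub>"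
      by (intro bexI[of _ "- x"]) (simp_all add: uminus_in_A)
  qed (simp_all add: add_in_A zero_in_A algebra_simps)
  show "monoid A"
    by (rule monoidI)
      (simp_all add: mult_in_A conv_assoc conv_one_left conv_one_right single_mem one_mem)
qed (simp_all add: conv_add_left conv_add_right)

lemma a_inv_A: "x \<in> carrier A \<Longrightarrow> \<ominus>\<^bsub>A\<^esub> x = - x"
  by (rule ring.minus_equality) (simp_all add: uminus_in_A)

lemma minus_A: "\<lbrakk>x \<in> carrier A; y \<in> carrier A\<rbrakk> \<Longrightarrow> x \<ominus>\<^bsub>A\<^esub> y = x - y"
  by (simp add: a_minus_def a_inv_A)

end

section \<open>Rings acting on abelian groups\<close>

text \<open>A left module over \<open>R\<close> whose additive group lives in a type. The vectors form a set \<open>V\<close> and the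
  laws are required on \<open>V\<close> only: the operators on tensor space obey the defining relations of the algebra
  of braids and ties on words of length \<open>n\<close>, whereas on lists that are too short they read unspecified entries.\<close>

locale ring_action = R?: ring R
  for R :: "('a, 'x) ring_scheme" (structure) +
  fixes V :: "'v::ab_group_add set" and act :: "'a \<Rightarrow> 'v \<Rightarrow> 'v"
  assumes act_mem: "\<lbrakk>x \<in> carrier R; v \<in> V\<rbrakk> \<Longrightarrow> act x v \<in> V"
    and act_add: "\<lbrakk>x \<in> carrier R; y \<in> carrier R; v \<in> V\<rbrakk> \<Longrightarrow> act (x \<oplus> y) v = act x v + act y v"
    and act_add_vector: "\<lbrakk>x \<in> carrier R; v \<in> V; w \<in> V\<rbrakk> \<Longrightarrow> act x (v + w) = act x v + act x w"
    and act_mult: "\<lbrakk>x \<in> carrier R; y \<in> carrier R; v \<in> V\<rbrakk> \<Longrightarrow> act (x \<otimes> y) v = act x (act y v)"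
    and act_one: "v \<in> V \<Longrightarrow> act \<one> v = v"
    and zero_vector_mem: "0 \<in> V"
    and add_vector_mem: "\<lbrakk>v \<in> V; w \<in> V\<rbrakk> \<Longrightarrow> v + w \<in> V"
begin

definition annihilator :: "'a set"
  where "annihilator = {x \<in> carrier R. \<forall>v\<in>V. act x v = 0}"

lemma act_zero: "v \<in> V \<Longrightarrow> act \<zero> v = 0"
  using act_add[of \<zero> \<zero> v] by simp

lemma act_zero_vector: "x \<in> carrier R \<Longrightarrow> act x 0 = 0"
  using act_add_vector[of x 0 0] by (simp add: zero_vector_mem)

lemma act_uminus: "\<lbrakk>x \<in> carrier R; v \<in> V\<rbrakk> \<Longrightarrow> act (\<ominus> x) v = - act x v"
  by (metis act_add act_zero add.inv_closed l_neg eq_neg_iff_add_eq_0)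

lemma act_minus: "\<lbrakk>x \<in> carrier R; y \<in> carrier R; v \<in> V\<rbrakk> \<Longrightarrow> act (x \<ominus> y) v = act x v - act y v"
  by (simp add: a_minus_def act_add act_uminus)

text \<open>This is what makes the action descend to a quotient: to kill an ideal it is enough to kill a
  set of generators.\<close>

lemma annihilator_ideal: "ideal annihilator R"
proof (rule idealI)
  show "subgroup annihilator (add_monoid R)"
    by (rule subgroup.intro)
      (auto simp: annihilator_def act_add act_zero act_uminus simp flip: a_inv_def)
qed (auto simp: annihilator_def act_mult act_zero_vector act_mem intro: ring_axioms)

text \<open>The choice of the representative is immaterial as soon as the ideal annihilates \<open>V\<close>.\<close>

definition quotient_act :: "'a set \<Rightarrow> 'v \<Rightarrow> 'v"
  where "quotient_act X = act (SOME x. x \<in> X)"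

context
  fixes I
  assumes I: "ideal I R" and I_annihilates: "I \<subseteq> annihilator"
begin

interpretation ideal I R by (rule I)

lemma quotient_act_coset:
  assumes x: "x \<in> carrier R" and v: "v \<in> V"
  shows "quotient_act (I +> x) v = act x v"
proof -
  define y where "y = (SOME y. y \<in> I +> x)"
  have y: "y \<in> I +> x"
    unfolding y_def using a_rcos_self[OF x] by (rule someI)
  then have y': "y \<in> carrier R"
    using a_elemrcos_carrier x by blast
  have "y \<ominus> x \<in> I"
    using a_rcos_module_minus[OF ring_axioms x y'] y by blast
  then have "act (y \<ominus> x) v = 0"
    using I_annihilates v by (auto simp: annihilator_def)
  then show ?thesis
    using x y' v by (simp add: act_minus quotient_act_def y_def)
qed

lemma quotient_ring_action: "ring_action (R Quot I) V quotient_act"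
proof -
  have coset: "\<exists>x\<in>carrier R. X = I +> x" if "X \<in> carrier (R Quot I)" for X
    using that by (auto simp: FactRing_simps)
  interpret Q: ring "R Quot I" by (rule quotient_is_ring)
  have h: "(+>) I \<in> ring_hom R (R Quot I)"
    by (rule rcos_ring_hom)
  note hom = ring_hom_add[OF h, symmetric] ring_hom_mult[OF h, symmetric] ring_hom_one[OF h, symmetric]
  show ?thesis
    by unfold_locales
      (auto dest!: coset simp: hom quotient_act_coset act_mem act_add act_add_vector act_mult act_one zero_vector_mem add_vector_mem)
qed

end

end

text \<open>The data from which a monoid ring acts: scalars \<open>s\<close> for the coefficients and a monoid of
  operators that commute with them. This is used for the free algebra (words act through their
  letters) and again for the group of formal sums of pairs that underlies a tensor product.\<close>

locale linear_monoid_action = monoid_ring_of M S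
  for M :: "('m, 'c) monoid_scheme" (structure) and S :: "'r::comm_ring_1 set" +
  fixes V :: "'v::ab_group_add set" and s :: "'r \<Rightarrow> 'v \<Rightarrow> 'v" and \<mu> :: "'m \<Rightarrow> 'v \<Rightarrow> 'v"
  assumes V_zero: "0 \<in> V"
    and V_add: "\<lbrakk>v \<in> V; w \<in> V\<rbrakk> \<Longrightarrow> v + w \<in> V"
    and V_scale: "\<lbrakk>c \<in> S; v \<in> V\<rbrakk> \<Longrightarrow> s c v \<in> V"
    and scale_add_left: "\<And>c d v. s (c + d) v = s c v + s d v"
    and scale_add_right: "\<And>c v w. s c (v + w) = s c v + s c w"
    and scale_mult: "\<And>c d v. s (c * d) v = s c (s d v)"
    and scale_one: "\<And>v. s 1 v = v"
    and \<mu>_mem: "\<lbrakk>a \<in> carrier M; v \<in> V\<rbrakk> \<Longrightarrow> \<mu> a v \<in> V"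
    and \<mu>_add: "\<lbrakk>a \<in> carrier M; v \<in> V; w \<in> V\<rbrakk> \<Longrightarrow> \<mu> a (v + w) = \<mu> a v + \<mu> a w"
    and \<mu>_scale: "\<lbrakk>a \<in> carrier M; v \<in> V; c \<in> S\<rbrakk> \<Longrightarrow> \<mu> a (s c v) = s c (\<mu> a v)"
    and \<mu>_mult: "\<lbrakk>a \<in> carrier M; b \<in> carrier M; v \<in> V\<rbrakk> \<Longrightarrow> \<mu> (a \<otimes> b) v = \<mu> a (\<mu> b v)"
    and \<mu>_one: "v \<in> V \<Longrightarrow> \<mu> \<one> v = v"
begin

definition ext :: "('m \<Rightarrow>\<^sub>0 'r) \<Rightarrow> 'v \<Rightarrow> 'v"
  where "ext x v = (\<Sum>a\<in>Poly_Mapping.keys x. s (Poly_Mapping.lookup x a) (\<mu> a v))"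

lemma scale_zero_left [simp]: "s 0 v = 0"
  using scale_add_left[of 0 0 v] by simp

lemma scale_zero_right [simp]: "s c 0 = 0"
  using scale_add_right[of c 0 0] by simp

lemma ext_zero [simp]: "ext 0 v = 0"
  by (simp add: ext_def)

lemma ext_single [simp]: "ext (Poly_Mapping.single a c) v = s c (\<mu> a v)"
  by (cases "c = 0") (simp_all add: ext_def)

lemma ext_add: "ext (x + y) v = ext x v + ext y v"
  unfolding ext_def by (rule setsum_keys_plus_distrib) (simp_all add: scale_add_left)

lemma ext_mem: "\<lbrakk>x \<in> carrier A; v \<in> V\<rbrakk> \<Longrightarrow> ext x v \<in> V"
  by (induction rule: carrier_induct) (simp_all add: V_zero V_scale \<mu>_mem ext_add V_add)

lemma ext_add_vector: "\<lbrakk>x \<in> carrier A; v \<in> V; w \<in> V\<rbrakk> \<Longrightarrow> ext x (v + w) = ext x v + ext x w"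
  by (induction rule: carrier_induct) (simp_all add: \<mu>_add scale_add_right ext_add algebra_simps)

text \<open>For monomials this is the multiplicativity of \<open>\<mu>\<close>, together with the fact that scalars can be
  moved past \<open>\<mu>\<close>; both sides are additive in \<open>x\<close> and in \<open>y\<close>.\<close>

lemma ext_mult:
  assumes x: "x \<in> carrier A" and y: "y \<in> carrier A" and v: "v \<in> V"
  shows "ext (conv (mult M) x y) v = ext x (ext y v)"
  using y
proof (induction rule: carrier_induct)
  case zero
  have "ext x 0 = 0" using ext_add_vector[OF x V_zero V_zero] by simp
  then show ?case by simp
next
  case (single b d)
  show ?case
    using x
    by (induction rule: carrier_induct)
      (simp_all add: conv_single_single conv_add_left ext_add scale_mult \<mu>_mult \<mu>_scale \<mu>_mem single v)
next
  case (add y y')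
  then show ?case by (simp add: conv_add_right ext_add ext_add_vector x ext_mem v)
qed

lemma ring_action_ext: "ring_action A V ext"
  by unfold_locales
    (simp_all add: ext_mem ext_add ext_add_vector ext_mult scale_one \<mu>_one V_zero V_add)

end

section \<open>The tensor product of two algebras\<close>

text \<open>The image of \<open>\<beta>\<close> has to be central so that the relators \<open>(\<beta> a b, c) - (b, \<gamma> a c)\<close> remain of the
  same form under multiplication by pairs; this makes the tensor product of \<open>B\<close> and \<open>C\<close> over \<open>A\<close> a ring.\<close>

locale algebra_pair = B: ring B + C: cring C
  for A :: "'a set" and B :: "('b, 'x) ring_scheme" and \<beta> :: "'a \<Rightarrow> 'b"
    and C :: "('c, 'y) ring_scheme" and \<gamma> :: "'a \<Rightarrow> 'c" +
  assumes \<beta>_closed: "a \<in> A \<Longrightarrow> \<beta> a \<in> carrier B"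
    and \<beta>_central: "\<lbrakk>a \<in> A; b \<in> carrier B\<rbrakk> \<Longrightarrow> \<beta> a \<otimes>\<^bsub>B\<^esub> b = b \<otimes>\<^bsub>B\<^esub> \<beta> a"
    and \<gamma>_closed: "a \<in> A \<Longrightarrow> \<gamma> a \<in> carrier C"
begin

sublocale P: monoid_ring_of "B \<times>\<times> C" "UNIV :: int set"
  by (intro monoid_ring_of.intro DirProd_monoid coefficient_ring_UNIV
      B.monoid_axioms C.monoid_axioms)

abbreviation \<R> :: "('b \<times> 'c \<Rightarrow>\<^sub>0 int) set"
  where "\<R> \<equiv> tensor_relators A B \<beta> C \<gamma>"

abbreviation \<K> :: "('b \<times> 'c \<Rightarrow>\<^sub>0 int) set"
  where "\<K> \<equiv> tensor_kernel A B \<beta> C \<gamma>"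

lemma gen_closed: "\<lbrakk>b \<in> carrier B; c \<in> carrier C\<rbrakk> \<Longrightarrow> pair_gen b c \<in> carrier (pair_ring B C)"
  by (simp add: P.single_mem)

lemma diff_closed:
  "\<lbrakk>x \<in> carrier (pair_ring B C); y \<in> carrier (pair_ring B C)\<rbrakk> \<Longrightarrow> x - y \<in> carrier (pair_ring B C)"
  using P.ring.minus_closed[of x y] by (simp add: P.minus_A)

lemma relators_closed: "\<R> \<subseteq> carrier (pair_ring B C)"
  by (auto simp: tensor_relators_def \<beta>_closed \<gamma>_closed intro!: diff_closed gen_closed P.add_in_A)

lemma kernel_subgroup: "subgroup \<K> (add_monoid (pair_ring B C))"
  unfolding tensor_kernel_def
  by (rule group.generate_is_subgroup[OF P.ring.a_group]) (simp add: relators_closed)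

lemma relators_subset_kernel: "\<R> \<subseteq> \<K>"
  by (auto simp: tensor_kernel_def intro: generate.incl)

lemma relator_add_left: "\<lbrakk>b \<in> carrier B; b' \<in> carrier B; c \<in> carrier C\<rbrakk> \<Longrightarrow>
    pair_gen (b \<oplus>\<^bsub>B\<^esub> b') c - (pair_gen b c + pair_gen b' c) \<in> \<R>"
  unfolding tensor_relators_def by (rule UnI1, rule UnI1) blast

lemma relator_add_right: "\<lbrakk>b \<in> carrier B; c \<in> carrier C; c' \<in> carrier C\<rbrakk> \<Longrightarrow>
    pair_gen b (c \<oplus>\<^bsub>C\<^esub> c') - (pair_gen b c + pair_gen b c') \<in> \<R>"
  unfolding tensor_relators_def by (rule UnI1, rule UnI2) blast

lemma relator_balance: "\<lbrakk>a \<in> A; b \<in> carrier B; c \<in> carrier C\<rbrakk> \<Longrightarrow>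
    pair_gen (\<beta> a \<otimes>\<^bsub>B\<^esub> b) c - pair_gen b (\<gamma> a \<otimes>\<^bsub>C\<^esub> c) \<in> \<R>"
  unfolding tensor_relators_def by (rule UnI2) blast

lemma relatorE [consumes 1, case_names add_left add_right balance]:
  assumes "r \<in> \<R>"
  obtains b b' c where "b \<in> carrier B" "b' \<in> carrier B" "c \<in> carrier C"
      "r = pair_gen (b \<oplus>\<^bsub>B\<^esub> b') c - (pair_gen b c + pair_gen b' c)"
    | b c c' where "b \<in> carrier B" "c \<in> carrier C" "c' \<in> carrier C"
      "r = pair_gen b (c \<oplus>\<^bsub>C\<^esub> c') - (pair_gen b c + pair_gen b c')"
    | a b c where "a \<in> A" "b \<in> carrier B" "c \<in> carrier C"
      "r = pair_gen (\<beta> a \<otimes>\<^bsub>B\<^esub> b) c - pair_gen b (\<gamma> a \<otimes>\<^bsub>C\<^esub> c)"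
  using assms unfolding tensor_relators_def
  by (elim UnE CollectE exE conjE) (erule (3) that(1) that(2) that(3))+

text \<open>The relators of each of the three kinds are stable under multiplication by pairs, on either side.
  For the third kind, a factor on the left has to be moved past \<open>\<beta> a\<close> and \<open>\<gamma> a\<close>; this is where
  centrality of \<open>\<beta> a\<close> and commutativity of \<open>C\<close> are needed.\<close>

lemma gen_mult_relator:
  assumes r: "r \<in> \<R>" and x: "x \<in> carrier B" and y: "y \<in> carrier C"
  shows "conv (mult (B \<times>\<times> C)) (pair_gen x y) r \<in> \<R>"
  using r
proof (cases rule: relatorE)
  case (add_left b b' c)
  then show ?thesis
    using relator_add_left[of "x \<otimes>\<^bsub>B\<^esub> b" "x \<otimes>\<^bsub>B\<^esub> b'" "y \<otimes>\<^bsub>C\<^esub> c"] x y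
    by (simp add: conv_minus_right conv_add_right conv_single_single B.r_distr)
next
  case (add_right b c c')
  then show ?thesis
    using relator_add_right[of "x \<otimes>\<^bsub>B\<^esub> b" "y \<otimes>\<^bsub>C\<^esub> c" "y \<otimes>\<^bsub>C\<^esub> c'"] x y
    by (simp add: conv_minus_right conv_add_right conv_single_single C.r_distr)
next
  case (balance a b c)
  have "x \<otimes>\<^bsub>B\<^esub> (\<beta> a \<otimes>\<^bsub>B\<^esub> b) = \<beta> a \<otimes>\<^bsub>B\<^esub> (x \<otimes>\<^bsub>B\<^esub> b)"
    using balance x by (metis B.m_assoc \<beta>_central \<beta>_closed)
  moreover have "y \<otimes>\<^bsub>C\<^esub> (\<gamma> a \<otimes>\<^bsub>C\<^esub> c) = \<gamma> a \<otimes>\<^bsub>C\<^esub> (y \<otimes>\<^bsub>C\<^esub> c)"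
    using balance y by (simp add: C.m_lcomm \<gamma>_closed)
  ultimately show ?thesis
    using balance relator_balance[of a "x \<otimes>\<^bsub>B\<^esub> b" "y \<otimes>\<^bsub>C\<^esub> c"] x y
    by (simp add: conv_minus_right conv_single_single)
qed

lemma relator_mult_gen:
  assumes r: "r \<in> \<R>" and x: "x \<in> carrier B" and y: "y \<in> carrier C"
  shows "conv (mult (B \<times>\<times> C)) r (pair_gen x y) \<in> \<R>"
  using r
proof (cases rule: relatorE)
  case (add_left b b' c)
  then show ?thesis
    using relator_add_left[of "b \<otimes>\<^bsub>B\<^esub> x" "b' \<otimes>\<^bsub>B\<^esub> x" "c \<otimes>\<^bsub>C\<^esub> y"] x y
    by (simp add: conv_minus_left conv_add_left conv_single_single B.l_distr)
next
  case (add_right b c c')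
  then show ?thesis
    using relator_add_right[of "b \<otimes>\<^bsub>B\<^esub> x" "c \<otimes>\<^bsub>C\<^esub> y" "c' \<otimes>\<^bsub>C\<^esub> y"] x y
    by (simp add: conv_minus_left conv_add_left conv_single_single C.l_distr)
next
  case (balance a b c)
  then show ?thesis
    using relator_balance[of a "b \<otimes>\<^bsub>B\<^esub> x" "c \<otimes>\<^bsub>C\<^esub> y"] x y
    by (simp add: conv_minus_left conv_single_single B.m_assoc C.m_assoc \<beta>_closed \<gamma>_closed)
qed

lemma kernel_diff:
  assumes "x \<in> \<K>" and "y \<in> \<K>"
  shows "x - y \<in> \<K>"
proof -
  have y: "y \<in> carrier (pair_ring B C)"
    using subgroup.mem_carrier[OF kernel_subgroup] assms(2) by simp
  have "inv\<^bsub>add_monoid (pair_ring B C)\<^esub> y \<in> \<K>"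
    by (rule subgroup.m_inv_closed[OF kernel_subgroup assms(2)])
  then have "- y \<in> \<K>"
    using P.a_inv_A[OF y] by (simp add: a_inv_def)
  then show ?thesis
    using subgroup.m_closed[OF kernel_subgroup assms(1), of "- y"] by simp
qed

lemma zero_in_kernel: "0 \<in> \<K>"
  using subgroup.one_closed[OF kernel_subgroup] by simp

lemma mult_relator:
  assumes "r \<in> \<R>" and "x \<in> carrier (pair_ring B C)"
  shows "conv (mult (B \<times>\<times> C)) x r \<in> \<K>" and "conv (mult (B \<times>\<times> C)) r x \<in> \<K>"
proof -
  have "Poly_Mapping.keys x \<subseteq> carrier B \<times> carrier C"
    using assms(2) by (simp add: P.carrier_A)
  then have "conv (mult (B \<times>\<times> C)) x r \<in> \<K> \<and> conv (mult (B \<times>\<times> C)) r x \<in> \<K>"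
  proof (induction x rule: frag_induction)
    case (one p)
    then show ?case
      using gen_mult_relator[OF assms(1)] relator_mult_gen[OF assms(1)] relators_subset_kernel
      by (cases p) auto
  qed (simp_all add: zero_in_kernel kernel_diff conv_minus_left conv_minus_right)
  then show "conv (mult (B \<times>\<times> C)) x r \<in> \<K>" and "conv (mult (B \<times>\<times> C)) r x \<in> \<K>"
    by auto
qed

lemma kernel_add: "\<lbrakk>x \<in> \<K>; y \<in> \<K>\<rbrakk> \<Longrightarrow> x + y \<in> \<K>"
  using subgroup.m_closed[OF kernel_subgroup, of x y] by simp

text \<open>Membership in the generated subgroup, with the group operations written as those of the type.\<close>

lemma kernel_induct [consumes 1, case_names zero relator minus_relator add]:
  assumes "r \<in> \<K>"
    and zero: "Q 0"
    and relator: "\<And>r. r \<in> \<R> \<Longrightarrow> Q r"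
    and minus_relator: "\<And>r. r \<in> \<R> \<Longrightarrow> Q (0 - r)"
    and add: "\<And>r r'. \<lbrakk>Q r; Q r'\<rbrakk> \<Longrightarrow> Q (r + r')"
  shows "Q r"
  using assms(1) unfolding tensor_kernel_def
proof (induction r rule: generate.induct)
  case (inv r)
  have "inv\<^bsub>add_monoid (pair_ring B C)\<^esub> r = 0 - r"
    using P.a_inv_A[of r] relators_closed inv by (auto simp: a_inv_def)
  then show ?case
    using minus_relator[OF inv] by simp
qed (simp_all add: zero relator add)

text \<open>The kernel is defined as an additive subgroup. It absorbs products because the ring is additively
  generated by the pairs, and pairs map relators to relators.\<close>

lemma kernel_ideal: "ideal \<K> (pair_ring B C)"
proof (rule idealI)
  fix r x assume r: "r \<in> \<K>" and x: "x \<in> carrier (pair_ring B C)"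
  have "conv (mult (B \<times>\<times> C)) x r \<in> \<K> \<and> conv (mult (B \<times>\<times> C)) r x \<in> \<K>"
    using r
    by (induction rule: kernel_induct)
      (simp_all add: conv_add_left conv_add_right conv_minus_left conv_minus_right zero_in_kernel
        kernel_add kernel_diff mult_relator[OF _ x] del: diff_0)
  then show "x \<otimes>\<^bsub>pair_ring B C\<^esub> r \<in> \<K>" and "r \<otimes>\<^bsub>pair_ring B C\<^esub> x \<in> \<K>"
    by simp_all
qed (rule P.ring.ring_axioms kernel_subgroup)+

sublocale K: ideal \<K> "pair_ring B C"
  by (rule kernel_ideal)

abbreviation \<T> :: "('b \<times> 'c \<Rightarrow>\<^sub>0 int) set ring"
  where "\<T> \<equiv> tensor_ring A B \<beta> C \<gamma>"

abbreviation tensor :: "'b \<Rightarrow> 'c \<Rightarrow> ('b \<times> 'c \<Rightarrow>\<^sub>0 int) set"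
  where "tensor \<equiv> pure_tensor A B \<beta> C \<gamma>"

lemma coset_hom: "(\<lambda>x. \<K> +>\<^bsub>pair_ring B C\<^esub> x) \<in> ring_hom (pair_ring B C) \<T>"
  unfolding tensor_ring_def by (rule K.rcos_ring_hom)

lemma coset_eq_if_diff_relator:
  assumes "x - y \<in> \<R>" and x: "x \<in> carrier (pair_ring B C)" and y: "y \<in> carrier (pair_ring B C)"
  shows "\<K> +>\<^bsub>pair_ring B C\<^esub> x = \<K> +>\<^bsub>pair_ring B C\<^esub> y"
proof -
  have "x \<ominus>\<^bsub>pair_ring B C\<^esub> y \<in> \<K>"
    using assms relators_subset_kernel by (auto simp: P.minus_A)
  then have "x \<in> \<K> +>\<^bsub>pair_ring B C\<^esub> y"
    using K.a_rcos_module_minus[OF P.ring.ring_axioms y x] by simp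
  then show ?thesis
    using K.a_repr_independence'[OF _ y] by simp
qed

text \<open>Additivity is the second kind of relator; the other laws already hold for the pairs.\<close>

lemma scalar_hom: "(\<lambda>c. tensor \<one>\<^bsub>B\<^esub> c) \<in> ring_hom C \<T>"
proof (rule ring_hom_memI)
  show "tensor \<one>\<^bsub>B\<^esub> c \<in> carrier \<T>" if c: "c \<in> carrier C" for c
    unfolding pure_tensor_def by (intro ring_hom_closed[OF coset_hom] gen_closed B.one_closed c)
next
  fix c d assume c: "c \<in> carrier C" and d: "d \<in> carrier C"
  show "tensor \<one>\<^bsub>B\<^esub> (c \<otimes>\<^bsub>C\<^esub> d) = tensor \<one>\<^bsub>B\<^esub> c \<otimes>\<^bsub>\<T>\<^esub> tensor \<one>\<^bsub>B\<^esub> d"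
    using ring_hom_mult[OF coset_hom, of "pair_gen \<one>\<^bsub>B\<^esub> c" "pair_gen \<one>\<^bsub>B\<^esub> d"]
    by (simp add: pure_tensor_def gen_closed c d conv_single_single)
  have "tensor \<one>\<^bsub>B\<^esub> (c \<oplus>\<^bsub>C\<^esub> d) = \<K> +>\<^bsub>pair_ring B C\<^esub> (pair_gen \<one>\<^bsub>B\<^esub> c + pair_gen \<one>\<^bsub>B\<^esub> d)"
    unfolding pure_tensor_def
    by (intro coset_eq_if_diff_relator relator_add_right gen_closed P.add_in_A C.a_closed
        B.one_closed c d)
  then show "tensor \<one>\<^bsub>B\<^esub> (c \<oplus>\<^bsub>C\<^esub> d) = tensor \<one>\<^bsub>B\<^esub> c \<oplus>\<^bsub>\<T>\<^esub> tensor \<one>\<^bsub>B\<^esub> d"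
    using ring_hom_add[OF coset_hom, of "pair_gen \<one>\<^bsub>B\<^esub> c" "pair_gen \<one>\<^bsub>B\<^esub> d"]
    by (simp add: pure_tensor_def gen_closed c d)
next
  show "tensor \<one>\<^bsub>B\<^esub> \<one>\<^bsub>C\<^esub> = \<one>\<^bsub>\<T>\<^esub>"
    using ring_hom_one[OF coset_hom] by (simp add: pure_tensor_def)
qed

text \<open>Centrality holds before passing to the quotient, since \<open>C\<close> is commutative and the other component is the
  unit.\<close>

lemma scalar_central:
  assumes c: "c \<in> carrier C" and X: "X \<in> carrier \<T>"
  shows "tensor \<one>\<^bsub>B\<^esub> c \<otimes>\<^bsub>\<T>\<^esub> X = X \<otimes>\<^bsub>\<T>\<^esub> tensor \<one>\<^bsub>B\<^esub> c"
proof -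
  obtain x where x: "x \<in> carrier (pair_ring B C)" "X = \<K> +>\<^bsub>pair_ring B C\<^esub> x"
    using X unfolding tensor_ring_def FactRing_def A_RCOSETS_def' by auto
  have "conv (mult (B \<times>\<times> C)) (pair_gen \<one>\<^bsub>B\<^esub> c) x = conv (mult (B \<times>\<times> C)) x (pair_gen \<one>\<^bsub>B\<^esub> c)"
    using x(1)
    by (induction rule: P.carrier_induct)
      (auto simp: conv_single_single conv_add_left conv_add_right C.m_comm c)
  then show ?thesis
    using ring_hom_mult[OF coset_hom, of "pair_gen \<one>\<^bsub>B\<^esub> c" x]
      ring_hom_mult[OF coset_hom, of x "pair_gen \<one>\<^bsub>B\<^esub> c"] x c
    by (simp add: pure_tensor_def gen_closed)
qed

end

section \<open>Modules over a tensor product\<close>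

text \<open>Integer multiples are iterated sums and differences, hence compatible with every additive map.
  They are the coefficients in the group of formal sums of pairs.\<close>

lemma (in ring_action) int_scale_mem_and_commute:
  assumes z: "Modules.module z" and v: "v \<in> V"
  shows "z k v \<in> V \<and> (\<forall>x\<in>carrier R. act x (z k v) = z (k :: int) (act x v))"
proof -
  interpret z: Modules.module z by (rule z)
  have V_uminus: "- w \<in> V" if "w \<in> V" for w
    using act_mem[of "\<ominus> \<one>" w] act_uminus[of \<one> w] act_one[OF that] that by simp
  have V_diff: "w - w' \<in> V" if "w \<in> V" "w' \<in> V" for w w'
    using add_vector_mem[OF that(1) V_uminus[OF that(2)]] by simp
  have act_diff: "act x (w - w') = act x w - act x w'" if "x \<in> carrier R" "w \<in> V" "w' \<in> V" for x w w'
    using act_add_vector[OF that(1) V_diff[OF that(2,3)] that(3)] by simp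
  show ?thesis
    by (induction k rule: int_induct[where k = 0])
      (simp_all add: zero_vector_mem act_zero_vector z.scale_left_distrib add_vector_mem v
        act_add_vector z.scale_left_diff_distrib V_diff act_diff)
qed

text \<open>Commuting actions of \<open>B\<close> and \<open>C\<close> on \<open>V\<close> that agree on \<open>A\<close> make \<open>V\<close> a module over the tensor
  product: the pair \<open>(b, c)\<close> acts as the composite, and the relators act as zero.\<close>

locale compatible_actions = algebra_pair A B \<beta> C \<gamma> +
  \<rho>: ring_action B V \<rho> + \<sigma>: ring_action C V \<sigma> + z: Modules.module z
  for A :: "'a set" and B :: "('b, 'x) ring_scheme" and \<beta> :: "'a \<Rightarrow> 'b"
    and C :: "('c, 'y) ring_scheme" and \<gamma> :: "'a \<Rightarrow> 'c"
    and V :: "'v::ab_group_add set" and \<rho> \<sigma> and z :: "int \<Rightarrow> 'v \<Rightarrow> 'v" +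
  assumes commute: "\<lbrakk>b \<in> carrier B; c \<in> carrier C; v \<in> V\<rbrakk> \<Longrightarrow> \<rho> b (\<sigma> c v) = \<sigma> c (\<rho> b v)"
    and agree: "\<lbrakk>a \<in> A; v \<in> V\<rbrakk> \<Longrightarrow> \<rho> (\<beta> a) v = \<sigma> (\<gamma> a) v"
begin

sublocale pair: linear_monoid_action "B \<times>\<times> C" "UNIV :: int set" V z "\<lambda>(b, c) v. \<sigma> c (\<rho> b v)"
proof unfold_locales
  fix p q :: "'b \<times> 'c" and v w k
  assume p: "p \<in> carrier (B \<times>\<times> C)"
  show "v \<in> V \<Longrightarrow> (case p of (b, c) \<Rightarrow> \<lambda>v. \<sigma> c (\<rho> b v)) v \<in> V"
    using p by (auto simp: \<rho>.act_mem \<sigma>.act_mem)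
  show "\<lbrakk>v \<in> V; w \<in> V\<rbrakk> \<Longrightarrow> (case p of (b, c) \<Rightarrow> \<lambda>v. \<sigma> c (\<rho> b v)) (v + w) =
      (case p of (b, c) \<Rightarrow> \<lambda>v. \<sigma> c (\<rho> b v)) v + (case p of (b, c) \<Rightarrow> \<lambda>v. \<sigma> c (\<rho> b v)) w"
    using p by (auto simp: \<rho>.act_mem \<rho>.act_add_vector \<sigma>.act_add_vector)
  show "v \<in> V \<Longrightarrow> (case p of (b, c) \<Rightarrow> \<lambda>v. \<sigma> c (\<rho> b v)) (z k v) =
      z k ((case p of (b, c) \<Rightarrow> \<lambda>v. \<sigma> c (\<rho> b v)) v)"
    using p by (auto simp: \<rho>.act_mem
        \<rho>.int_scale_mem_and_commute[OF z.module_axioms] \<sigma>.int_scale_mem_and_commute[OF z.module_axioms])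
  assume q: "q \<in> carrier (B \<times>\<times> C)"
  show "v \<in> V \<Longrightarrow> (case p \<otimes>\<^bsub>B \<times>\<times> C\<^esub> q of (b, c) \<Rightarrow> \<lambda>v. \<sigma> c (\<rho> b v)) v =
      (case p of (b, c) \<Rightarrow> \<lambda>v. \<sigma> c (\<rho> b v)) ((case q of (b, c) \<Rightarrow> \<lambda>v. \<sigma> c (\<rho> b v)) v)"
    using p q by (auto simp: \<rho>.act_mem \<sigma>.act_mem \<rho>.act_mult \<sigma>.act_mult commute)
next
  show "v \<in> V \<Longrightarrow> (case \<one>\<^bsub>B \<times>\<times> C\<^esub> of (b, c) \<Rightarrow> \<lambda>v. \<sigma> c (\<rho> b v)) v = v" for v
    by (simp add: \<rho>.act_one \<sigma>.act_one)
  show "v \<in> V \<Longrightarrow> z k v \<in> V" for k v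
    using \<rho>.int_scale_mem_and_commute[OF z.module_axioms] by blast
qed (simp_all add: \<rho>.zero_vector_mem \<rho>.add_vector_mem z.scale_left_distrib z.scale_right_distrib)

sublocale pair: ring_action "pair_ring B C" V pair.ext
  by (rule pair.ring_action_ext)

lemma kernel_annihilates: "\<K> \<subseteq> pair.annihilator"
proof -
  have "\<R> \<subseteq> pair.annihilator"
  proof
    fix r assume r: "r \<in> \<R>"
    have ext_diff: "pair.ext (x - y) v = pair.ext x v - pair.ext y v" for x y v
      by (metis pair.ext_add diff_add_cancel add_diff_cancel_right')
    have "pair.ext r v = 0" if v: "v \<in> V" for v
      using r
      by (cases rule: relatorE)
        (simp_all add: ext_diff pair.ext_add v \<rho>.act_add \<rho>.act_mult \<rho>.act_mem \<sigma>.act_add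
          \<sigma>.act_mult \<sigma>.act_mem \<sigma>.act_add_vector agree \<beta>_closed \<gamma>_closed C.m_comm
          flip: \<sigma>.act_mult)
    then show "r \<in> pair.annihilator"
      using r relators_closed by (auto simp: pair.annihilator_def)
  qed
  then show ?thesis
    unfolding tensor_kernel_def
    using pair.annihilator_ideal
    by (meson P.ring.a_group additive_subgroup.a_subgroup group.generate_subgroup_incl ideal.axioms(1))
qed

lemma tensor_ring_action: "ring_action \<T> V pair.quotient_act"
  unfolding tensor_ring_def
  by (rule pair.quotient_ring_action[OF kernel_ideal kernel_annihilates])

lemma tensor_act:
  "\<lbrakk>b \<in> carrier B; c \<in> carrier C; v \<in> V\<rbrakk> \<Longrightarrow> pair.quotient_act (tensor b c) v = \<sigma> c (\<rho> b v)"
  unfolding pure_tensor_def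
  by (simp add: pair.quotient_act_coset[OF kernel_ideal kernel_annihilates] gen_closed)

end

section \<open>The coefficient rings\<close>

lemma coefficient_ring_laurent_polys: "coefficient_ring laurent_polys"
proof
  have Fract_mem: "Fract p (monom 1 k) \<in> laurent_polys" for p k
    by (auto simp: laurent_polys_def)
  have monom_nz: "monom (1::complex) k \<noteq> 0" for k
    by (simp add: monom_eq_0_iff)
  show "0 \<in> laurent_polys" and "1 \<in> laurent_polys"
    using Fract_mem[of 0 0] Fract_mem[of 1 0]
    by (simp_all add: Zero_fract_def One_fract_def flip: one_poly_eq_simps monom_eq_1)
  fix c d assume "c \<in> laurent_polys" and "d \<in> laurent_polys"
  then obtain p q k l where c: "c = Fract p (monom 1 k)" and d: "d = Fract q (monom 1 l)"
    by (auto simp: laurent_polys_def)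
  show "c + d \<in> laurent_polys" and "c * d \<in> laurent_polys"
    using Fract_mem by (simp_all add: c d monom_nz mult_monom)
next
  show "- c \<in> laurent_polys" if "c \<in> laurent_polys" for c
    using that by (force simp: laurent_polys_def)
qed

lemma indet_minus_one_mem: "indet - 1 \<in> laurent_polys"
proof -
  interpret coefficient_ring laurent_polys by (rule coefficient_ring_laurent_polys)
  have "indet = Fract [:0, 1:] (monom 1 0)"
    by (simp add: indet_def)
  then have "indet \<in> laurent_polys"
    unfolding laurent_polys_def by blast
  then show ?thesis
    using add_mem[OF _ uminus_mem[OF one_mem]] by fastforce
qed

lemma cring_ratfun_field: "cring ratfun_field"
proof (rule cringI)
  show "abelian_group ratfun_field"
  proof (rule abelian_groupI)
    show "\<exists>y\<in>carrier ratfun_field. y \<oplus>\<^bsub>ratfun_field\<^esub> x = \<zero>\<^bsub>ratfun_field\<^esub>" for x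
      by (auto simp: ratfun_field_def intro!: exI[of _ "- x"])
  qed (simp_all add: ratfun_field_def algebra_simps)
  show "comm_monoid ratfun_field"
    by (rule comm_monoidI) (simp_all add: ratfun_field_def algebra_simps)
qed (simp_all add: ratfun_field_def algebra_simps)

section \<open>Linear maps on free modules\<close>

lemma lookup_scale [simp]: "Poly_Mapping.lookup (scale c x) a = c * Poly_Mapping.lookup x a"
  by (simp add: scale_def Poly_Mapping.map.rep_eq when_def)

lemma scale_single [simp]: "scale c (Poly_Mapping.single a d) = Poly_Mapping.single a (c * d)"
  by (rule poly_mapping_eqI) (simp add: lookup_single when_def)

interpretation scale: Modules.module scale
  by unfold_locales (auto intro!: poly_mapping_eqI simp: lookup_add algebra_simps)

lemma keys_scale: "Poly_Mapping.keys (scale c x) \<subseteq> Poly_Mapping.keys x"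
  by (auto simp: in_keys_iff)

abbreviation klinear :: "(('a \<Rightarrow>\<^sub>0 'k) \<Rightarrow> ('b \<Rightarrow>\<^sub>0 'k::comm_ring_1)) \<Rightarrow> bool"
  where "klinear \<equiv> module_hom scale scale"

lemma lin_ext_single [simp]: "lin_ext f (Poly_Mapping.single a c) = scale c (f a)"
  by (cases "c = 0") (simp_all add: lin_ext_def)

lemma klinear_lin_ext: "klinear (lin_ext f)"
proof
  show add: "lin_ext f (x + y) = lin_ext f x + lin_ext f y" for x y
    unfolding lin_ext_def
    by (rule setsum_keys_plus_distrib) (simp_all add: scale.scale_left_distrib)
  show "lin_ext f (scale c x) = scale c (lin_ext f x)" for c x
  proof -
    have "lin_ext f (scale c x) = (\<Sum>a\<in>Poly_Mapping.keys x. scale (c * Poly_Mapping.lookup x a) (f a))"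
      unfolding lin_ext_def
      by (rule sum.mono_neutral_cong_left) (auto simp: keys_scale in_keys_iff)
    then show ?thesis
      by (simp add: lin_ext_def scale.scale_sum_right)
  qed
qed

lemma sum_scaled_basis:
  "(\<Sum>a\<in>Poly_Mapping.keys x. scale (Poly_Mapping.lookup x a) (Poly_Mapping.single a 1)) = x"
  by (rule poly_mapping_eqI) (simp add: lookup_sum lookup_single when_def in_keys_iff)

lemma klinear_eqI:
  assumes X: "klinear X" and Y: "klinear Y" and x: "Poly_Mapping.keys x \<subseteq> W"
    and basis: "\<And>w. w \<in> W \<Longrightarrow> X (Poly_Mapping.single w 1) = Y (Poly_Mapping.single w 1)"
  shows "X x = Y x"
proof -
  interpret X: module_hom scale scale X by (rule X)
  interpret Y: module_hom scale scale Y by (rule Y)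
  have "X (\<Sum>a\<in>Poly_Mapping.keys x. scale (Poly_Mapping.lookup x a) (Poly_Mapping.single a 1))
      = Y (\<Sum>a\<in>Poly_Mapping.keys x. scale (Poly_Mapping.lookup x a) (Poly_Mapping.single a 1))"
    unfolding X.sum Y.sum X.scale Y.scale
    by (intro sum.cong refl arg_cong[where f = "scale _"] basis) (use x in blast)
  then show ?thesis
    by (simp only: sum_scaled_basis)
qed

section \<open>The relations between the operators on tensor space\<close>

type_synonym operator = "(idx list \<Rightarrow>\<^sub>0 ratfun) \<Rightarrow> (idx list \<Rightarrow>\<^sub>0 ratfun)"

abbreviation bv :: "idx list \<Rightarrow> (idx list \<Rightarrow>\<^sub>0 ratfun)"
  where "bv w \<equiv> Poly_Mapping.single w 1"

text \<open>Both operators have the form \<open>X (p \<otimes> q) = a p q (q \<otimes> p) + b p q (p \<otimes> q)\<close>: the pair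
  \<open>(\<alpha>, \<beta>)\<close> gives \<open>T\<close>, and \<open>(0, \<delta>)\<close> gives \<open>E\<close>. For \<open>p = q\<close> the two basis vectors coincide, so that
  only \<open>a p p + b p p\<close> is determined, and the eigenvalue \<open>u\<close> of \<open>T\<close> is put into \<open>\<beta>\<close> entirely. With this
  choice the two sides of the braid relation agree coefficient by coefficient
  even when some of the three vectors are equal; with \<open>\<alpha> p p = u\<close> they would agree
  only after collecting equal basis vectors.\<close>

definition \<alpha> :: "idx \<Rightarrow> idx \<Rightarrow> ratfun"
  where "\<alpha> p q = (if p = q then 0 else if snd p \<noteq> snd q \<or> fst p < fst q then 1 else indet)"

definition \<beta> :: "idx \<Rightarrow> idx \<Rightarrow> ratfun"
  where "\<beta> p q = (if p = q then indet else if snd p = snd q \<and> fst p > fst q then indet - 1 else 0)"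

definition \<delta> :: "idx \<Rightarrow> idx \<Rightarrow> ratfun"
  where "\<delta> p q = (if snd p = snd q then 1 else 0)"

lemma klinear_act_at: "klinear (act_at i F)"
  unfolding act_at_def by (rule klinear_lin_ext)

lemmas act_at_add [simp] = module_hom.add[OF klinear_act_at]
  and act_at_scale [simp] = module_hom.scale[OF klinear_act_at]

lemma act_at_split:
  assumes "i = Suc (length xs)"
  shows "act_at i F (bv (xs @ p # q # ys))
    = lin_ext (\<lambda>(p, q). bv (xs @ p # q # ys)) (F (p \<otimes>\<^sub>V q))"
  using assms by (simp add: act_at_def nth_append list_update_append)

lemma act_at_T_split:
  assumes "i = Suc (length xs)"
  shows "act_at i T_op (bv (xs @ p # q # ys))
    = scale (\<alpha> p q) (bv (xs @ q # p # ys)) + scale (\<beta> p q) (bv (xs @ p # q # ys))"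
  unfolding act_at_split[OF assms]
  by (cases p; cases q)
    (auto simp: T_op_def \<alpha>_def \<beta>_def module_hom.add[OF klinear_lin_ext])

lemma act_at_E_split:
  assumes "i = Suc (length xs)"
  shows "act_at i E_op (bv (xs @ p # q # ys)) = scale (\<delta> p q) (bv (xs @ p # q # ys))"
  unfolding act_at_split[OF assms]
  by (cases p; cases q) (auto simp: E_op_def \<delta>_def module_hom.zero[OF klinear_lin_ext])

lemma split_at_pair:
  assumes "i \<in> {1..<length w}"
  obtains xs p q ys where "w = xs @ p # q # ys" and "i = Suc (length xs)"
proof
  have "drop (i - 1) w = w ! (i - 1) # w ! i # drop (Suc i) w"
    using assms Cons_nth_drop_Suc[of "i - 1" w, symmetric] Cons_nth_drop_Suc[of i w, symmetric]
    by (simp add: less_imp_diff_less)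
  then show "w = take (i - 1) w @ w ! (i - 1) # w ! i # drop (Suc i) w"
    by (metis append_take_drop_id)
  show "i = Suc (length (take (i - 1) w))"
    using assms by auto
qed

lemma split_at_triple:
  assumes "i \<in> {1..<length w}" and "Suc i \<in> {1..<length w}"
  obtains xs p q r ys where "w = xs @ p # q # r # ys" and "i = Suc (length xs)"
proof -
  obtain xs p q ys where w: "w = xs @ p # q # ys" "i = Suc (length xs)"
    using split_at_pair[OF assms(1)] by blast
  then show ?thesis
    using assms(2) that by (cases ys) auto
qed

lemma split_at_two_pairs:
  assumes "i \<in> {1..<length w}" and "j \<in> {1..<length w}" and "Suc i < j"
  obtains xs p q ys r s zs where "w = xs @ p # q # ys @ r # s # zs"
    and "i = Suc (length xs)" and "j = Suc (length (xs @ p # q # ys))"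
proof -
  obtain xs p q us where w: "w = xs @ p # q # us" "i = Suc (length xs)"
    using split_at_pair[OF assms(1)] by blast
  have "j - Suc i \<in> {1..<length us}"
    using assms w by auto
  then obtain ys r s zs where "us = ys @ r # s # zs" "j - Suc i = Suc (length ys)"
    using split_at_pair by blast
  then show ?thesis
    using that[of xs p q ys r s zs] w assms(3) by auto
qed

lemmas expand = scale.scale_left_distrib scale.scale_right_distrib scale.scale_scale

text \<open>The operators touch disjoint pairs of tensor factors. Stated for arbitrary coefficients so that it
  serves both for two \<open>T\<close> and for an \<open>E\<close> with a \<open>T\<close>.\<close>

lemma far_commute:
  assumes "i \<in> {1..<length w}" and "j \<in> {1..<length w}" and "Suc i < j"
    and X: "klinear X"
      "\<And>xs p q ys. i = Suc (length xs) \<Longrightarrow> X (bv (xs @ p # q # ys))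
        = scale (a p q) (bv (xs @ q # p # ys)) + scale (b p q) (bv (xs @ p # q # ys))"
    and Y: "klinear Y"
      "\<And>xs p q ys. j = Suc (length xs) \<Longrightarrow> Y (bv (xs @ p # q # ys))
        = scale (c p q) (bv (xs @ q # p # ys)) + scale (d p q) (bv (xs @ p # q # ys))"
  shows "X (Y (bv w)) = Y (X (bv w))"
proof -
  interpret X: module_hom scale scale X by (rule X(1))
  interpret Y: module_hom scale scale Y by (rule Y(1))
  obtain xs p q ys r s zs where w: "w = xs @ p # q # ys @ r # s # zs"
    and i: "i = Suc (length xs)" and j: "j = Suc (length (xs @ p # q # ys))"
    using split_at_two_pairs[OF assms(1-3)] by blast
  have "Y (bv (xs @ p' # q' # ys @ r' # s' # zs))
      = scale (c r' s') (bv (xs @ p' # q' # ys @ s' # r' # zs))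
        + scale (d r' s') (bv (xs @ p' # q' # ys @ r' # s' # zs))" for p' q' r' s'
    using Y(2)[of "xs @ p' # q' # ys" r' s' zs] j by simp
  note Y_split = this
  show ?thesis
    unfolding w Y_split X(2)[OF i] X.add Y.add X.scale Y.scale expand
    by (simp add: ac_simps)
qed

text \<open>The coefficients of \<open>p \<otimes> q \<otimes> r\<close>, \<open>q \<otimes> p \<otimes> r\<close> and \<open>p \<otimes> r \<otimes> q\<close> in the two sides of the braid
  relation applied to \<open>p \<otimes> q \<otimes> r\<close>; for the other three permutations the coefficients are
  visibly equal.\<close>

lemma braid_coefficients:
  "\<alpha> p q * \<alpha> q p * \<beta> p r + \<beta> q r * (\<beta> p q * \<beta> p q) = \<alpha> q r * \<alpha> r q * \<beta> p r + \<beta> p q * (\<beta> q r * \<beta> q r)"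
  "\<alpha> p q * (\<beta> p r * \<beta> q p + \<beta> p q * \<beta> q r) = \<alpha> p q * (\<beta> q r * \<beta> p r)"
  "\<alpha> q r * (\<beta> p q * \<beta> p r) = \<alpha> q r * (\<beta> p r * \<beta> r q + \<beta> q r * \<beta> p q)"
  by (cases p; cases q; cases r; auto simp: \<alpha>_def \<beta>_def algebra_simps)+

text \<open>The coefficients of \<open>p \<otimes> q\<close> and \<open>q \<otimes> p\<close> in the quadratic relation.\<close>

lemma quadratic_coefficients:
  "\<alpha> p q * \<alpha> q p + \<beta> p q * \<beta> p q = 1 + (indet - 1) * \<delta> p q * (1 + \<beta> p q)"
  "\<alpha> p q * (\<beta> q p + \<beta> p q) = (indet - 1) * \<delta> p q * \<alpha> p q"
  by (cases p; cases q; auto simp: \<alpha>_def \<beta>_def \<delta>_def algebra_simps)+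

context
  fixes i :: nat and w :: "idx list"
  assumes i: "i \<in> {1..<length w}"
begin

lemma E_diagonal: "\<exists>c. act_at i E_op (bv w) = scale c (bv w)"
proof -
  obtain xs p q ys where "w = xs @ p # q # ys" "i = Suc (length xs)"
    using split_at_pair[OF i] by blast
  then show ?thesis using act_at_E_split by blast
qed

lemma E_idempotent: "act_at i E_op (act_at i E_op (bv w)) = act_at i E_op (bv w)"
proof -
  obtain xs p q ys where w: "w = xs @ p # q # ys" and i: "i = Suc (length xs)"
    using split_at_pair[OF i] by blast
  show ?thesis
    unfolding w by (simp add: act_at_E_split[OF i] \<delta>_def del: scale_single)
qed

lemma E_T_commute: "act_at i E_op (act_at i T_op (bv w)) = act_at i T_op (act_at i E_op (bv w))"
proof -
  obtain xs p q ys where w: "w = xs @ p # q # ys" and i: "i = Suc (length xs)"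
    using split_at_pair[OF i] by blast
  show ?thesis
    unfolding w act_at_E_split[OF i] act_at_T_split[OF i] act_at_add act_at_scale
    by (simp add: \<delta>_def del: scale_single)
qed

lemma T_quadratic: "act_at i T_op (act_at i T_op (bv w))
  = bv w + scale (indet - 1) (act_at i E_op (bv w + act_at i T_op (bv w)))"
proof -
  obtain xs p q ys where w: "w = xs @ p # q # ys" and i: "i = Suc (length xs)"
    using split_at_pair[OF i] by blast
  let ?w = "bv (xs @ p # q # ys)" and ?w' = "bv (xs @ q # p # ys)"
  have \<delta>_sym: "\<delta> q p = \<delta> p q"
    by (simp add: \<delta>_def)
  have "act_at i T_op (act_at i T_op ?w)
      = scale (\<alpha> p q * \<alpha> q p + \<beta> p q * \<beta> p q) ?w + scale (\<alpha> p q * (\<beta> q p + \<beta> p q)) ?w'"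
    unfolding act_at_T_split[OF i] act_at_add act_at_scale expand distrib_left
    by (simp add: ac_simps del: scale_single)
  also have "\<dots> = scale (1 + (indet - 1) * \<delta> p q * (1 + \<beta> p q)) ?w
      + scale ((indet - 1) * \<delta> p q * \<alpha> p q) ?w'"
    by (simp only: quadratic_coefficients)
  also have "\<dots> = ?w + scale (indet - 1) (act_at i E_op (?w + act_at i T_op ?w))"
    unfolding act_at_T_split[OF i] act_at_E_split[OF i] act_at_add act_at_scale expand distrib_left \<delta>_sym
    by (simp add: ac_simps del: scale_single)
  finally show ?thesis
    unfolding w .
qed

end

lemma E_E_commute:
  assumes "i \<in> {1..<length w}" and "j \<in> {1..<length w}"
  shows "act_at i E_op (act_at j E_op (bv w)) = act_at j E_op (act_at i E_op (bv w))"
proof -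
  obtain c d where "act_at i E_op (bv w) = scale c (bv w)" "act_at j E_op (bv w) = scale d (bv w)"
    using assms E_diagonal by meson
  then show ?thesis
    by (simp add: mult.commute del: scale_single)
qed

context
  fixes i :: nat and w :: "idx list"
  assumes i: "i \<in> {1..<length w}" and Suc_i: "Suc i \<in> {1..<length w}"
begin

text \<open>All relations between neighbouring generators concern three consecutive tensor factors;
  \<open>B x y z\<close> is the given word with these three letters replaced.\<close>

lemma neighbours_basis:
  obtains B :: "idx \<Rightarrow> idx \<Rightarrow> idx \<Rightarrow> (idx list \<Rightarrow>\<^sub>0 ratfun)" and p q r
  where "bv w = B p q r"
    and "\<And>x y z. act_at i T_op (B x y z) = scale (\<alpha> x y) (B y x z) + scale (\<beta> x y) (B x y z)"
    and "\<And>x y z. act_at (Suc i) T_op (B x y z) = scale (\<alpha> y z) (B x z y) + scale (\<beta> y z) (B x y z)"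
    and "\<And>x y z. act_at i E_op (B x y z) = scale (\<delta> x y) (B x y z)"
    and "\<And>x y z. act_at (Suc i) E_op (B x y z) = scale (\<delta> y z) (B x y z)"
proof -
  obtain xs p q r ys where w: "w = xs @ p # q # r # ys" and i: "i = Suc (length xs)"
    using split_at_triple[OF i Suc_i] by blast
  show ?thesis
  proof (rule that[of "\<lambda>x y z. bv (xs @ x # y # z # ys)" p q r])
    fix x y z
    have Suc_i: "Suc i = Suc (length (xs @ [x]))"
      using i by simp
    show "act_at (Suc i) T_op (bv (xs @ x # y # z # ys))
        = scale (\<alpha> y z) (bv (xs @ x # z # y # ys)) + scale (\<beta> y z) (bv (xs @ x # y # z # ys))"
      using act_at_T_split[OF Suc_i, of y z ys] by simp
    show "act_at (Suc i) E_op (bv (xs @ x # y # z # ys)) = scale (\<delta> y z) (bv (xs @ x # y # z # ys))"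
      using act_at_E_split[OF Suc_i, of y z ys] by simp
  qed (simp_all only: w act_at_T_split[OF i] act_at_E_split[OF i])
qed

lemma T_braid:
  "act_at i T_op (act_at (Suc i) T_op (act_at i T_op (bv w)))
    = act_at (Suc i) T_op (act_at i T_op (act_at (Suc i) T_op (bv w)))" (is "?lhs = ?rhs")
proof -
  obtain B p q r where w: "bv w = B p q r"
    and T1: "\<And>x y z. act_at i T_op (B x y z) = scale (\<alpha> x y) (B y x z) + scale (\<beta> x y) (B x y z)"
    and T2: "\<And>x y z. act_at (Suc i) T_op (B x y z) = scale (\<alpha> y z) (B x z y) + scale (\<beta> y z) (B x y z)"
    using neighbours_basis by metis
  let ?common = "scale (\<alpha> p q * \<alpha> p r * \<alpha> q r) (B r q p) + scale (\<alpha> p q * \<alpha> p r * \<beta> q r) (B q r p)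
    + scale (\<beta> p q * \<alpha> q r * \<alpha> p r) (B r p q)"
  have "?lhs = ?common
      + scale (\<alpha> p q * \<alpha> q p * \<beta> p r + \<beta> q r * (\<beta> p q * \<beta> p q)) (B p q r)
      + scale (\<alpha> p q * (\<beta> p r * \<beta> q p + \<beta> p q * \<beta> q r)) (B q p r)
      + scale (\<alpha> q r * (\<beta> p q * \<beta> p r)) (B p r q)"
    unfolding w T1 T2 act_at_add act_at_scale expand distrib_left
    by (simp add: ac_simps)
  also have "\<dots> = ?common
      + scale (\<alpha> q r * \<alpha> r q * \<beta> p r + \<beta> p q * (\<beta> q r * \<beta> q r)) (B p q r)
      + scale (\<alpha> p q * (\<beta> q r * \<beta> p r)) (B q p r)
      + scale (\<alpha> q r * (\<beta> p r * \<beta> r q + \<beta> q r * \<beta> p q)) (B p r q)"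
    by (intro arg_cong2[where f = "(+)"] arg_cong2[where f = scale] refl braid_coefficients)
  also have "\<dots> = ?rhs"
    unfolding w T1 T2 act_at_add act_at_scale expand distrib_left
    by (simp add: ac_simps)
  finally show ?thesis .
qed

text \<open>The term of \<open>T\<close> with coefficient \<open>\<alpha>\<close> exchanges the upper indices together with the vectors. The term
  with coefficient \<open>\<beta>\<close> leaves them in place, but it occurs only when the two upper indices are equal, so
  that exchanging them would change nothing. Hence \<open>T\<close> permutes the upper indices, and it suffices to
  distinguish which of the three coincide.\<close>

lemma neighbour_ties:
  shows "act_at (Suc i) E_op (act_at i T_op (act_at (Suc i) T_op (bv w)))
      = act_at i T_op (act_at (Suc i) T_op (act_at i E_op (bv w)))"
    and "act_at i E_op (act_at (Suc i) T_op (act_at i T_op (bv w)))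
      = act_at (Suc i) T_op (act_at i T_op (act_at (Suc i) E_op (bv w)))"
    and "act_at i E_op (act_at (Suc i) E_op (act_at (Suc i) T_op (bv w)))
      = act_at i E_op (act_at (Suc i) T_op (act_at i E_op (bv w)))"
    and "act_at (Suc i) E_op (act_at i E_op (act_at i T_op (bv w)))
      = act_at (Suc i) E_op (act_at i T_op (act_at (Suc i) E_op (bv w)))"
    and "act_at i E_op (act_at (Suc i) T_op (act_at i E_op (bv w)))
      = act_at (Suc i) T_op (act_at i E_op (act_at (Suc i) E_op (bv w)))"
    and "act_at (Suc i) E_op (act_at i T_op (act_at (Suc i) E_op (bv w)))
      = act_at i T_op (act_at (Suc i) E_op (act_at i E_op (bv w)))"
proof -
  obtain B p q r where w: "bv w = B p q r"
    and T1: "\<And>x y z. act_at i T_op (B x y z) = scale (\<alpha> x y) (B y x z) + scale (\<beta> x y) (B x y z)"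
    and T2: "\<And>x y z. act_at (Suc i) T_op (B x y z) = scale (\<alpha> y z) (B x z y) + scale (\<beta> y z) (B x y z)"
    and E1: "\<And>x y z. act_at i E_op (B x y z) = scale (\<delta> x y) (B x y z)"
    and E2: "\<And>x y z. act_at (Suc i) E_op (B x y z) = scale (\<delta> y z) (B x y z)"
    using neighbours_basis by metis
  have \<beta>_zero: "\<beta> x y = 0" if "snd x \<noteq> snd y" for x y
    using that by (auto simp: \<beta>_def)
  note operators = w T1 T2 E1 E2 act_at_add act_at_scale
  show "act_at (Suc i) E_op (act_at i T_op (act_at (Suc i) T_op (bv w)))
      = act_at i T_op (act_at (Suc i) T_op (act_at i E_op (bv w)))"
    and "act_at i E_op (act_at (Suc i) T_op (act_at i T_op (bv w)))
      = act_at (Suc i) T_op (act_at i T_op (act_at (Suc i) E_op (bv w)))"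
    and "act_at i E_op (act_at (Suc i) E_op (act_at (Suc i) T_op (bv w)))
      = act_at i E_op (act_at (Suc i) T_op (act_at i E_op (bv w)))"
    and "act_at (Suc i) E_op (act_at i E_op (act_at i T_op (bv w)))
      = act_at (Suc i) E_op (act_at i T_op (act_at (Suc i) E_op (bv w)))"
    and "act_at i E_op (act_at (Suc i) T_op (act_at i E_op (bv w)))
      = act_at (Suc i) T_op (act_at i E_op (act_at (Suc i) E_op (bv w)))"
    and "act_at (Suc i) E_op (act_at i T_op (act_at (Suc i) E_op (bv w)))
      = act_at i T_op (act_at (Suc i) E_op (act_at i E_op (bv w)))"
    unfolding operators
    by (cases "snd p = snd q"; cases "snd q = snd r"; cases "snd p = snd r";
        simp add: \<delta>_def \<beta>_zero)+
qed

end

section \<open>The action of the algebra of braids and ties\<close>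

fun gen_op :: "bt_gen \<Rightarrow> operator"
  where "gen_op (TGen i) = act_at i T_op"
  | "gen_op (EGen i) = act_at i E_op"

definition word_op :: "bt_gen list \<Rightarrow> operator"
  where "word_op w = foldr gen_op w"

lemma word_op_simps [simp]:
  "word_op [] v = v"
  "word_op (g # w) v = gen_op g (word_op w v)"
  "word_op (w @ w') v = word_op w (word_op w' v)"
  by (simp_all add: word_op_def)

lemma gen_op_linear [simp]:
  "gen_op g (v + v') = gen_op g v + gen_op g v'"
  "gen_op g (scale c v) = scale c (gen_op g v)"
  by (cases g; simp)+

lemma word_op_linear [simp]:
  "word_op w (v + v') = word_op w v + word_op w v'"
  "word_op w (scale c v) = scale c (word_op w v)"
  by (induction w) simp_all

lemma klinear_word_op: "klinear (word_op w)"
  by unfold_locales simp_all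

lemma free_monoid_simps [simp]:
  "carrier (free_monoid G) = lists G"
  "x \<otimes>\<^bsub>free_monoid G\<^esub> y = x @ y"
  "\<one>\<^bsub>free_monoid G\<^esub> = []"
  by (simp_all add: free_monoid_def)

lemma monoid_free_monoid: "monoid (free_monoid G)"
  by (rule monoidI) auto

context
  fixes n :: nat
begin

abbreviation (input) \<V> :: "(idx list \<Rightarrow>\<^sub>0 ratfun) set"
  where "\<V> \<equiv> carrier (tensor_space n)"

abbreviation (input) \<W> :: "idx list set"
  where "\<W> \<equiv> {w \<in> lists ({1..n} \<times> {1..n}). length w = n}"

definition \<G> :: "bt_gen set"
  where "\<G> = TGen ` {1..<n} \<union> EGen ` {1..<n}"

lemma gens_iff [simp]: "TGen i \<in> \<G> \<longleftrightarrow> i \<in> {1..<n}" "EGen i \<in> \<G> \<longleftrightarrow> i \<in> {1..<n}"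
  by (auto simp: \<G>_def)

lemma bt_free_algebra_eq: "bt_free_algebra n = monoid_ring laurent_polys (free_monoid \<G>)"
  by (simp only: bt_free_algebra_def \<G>_def)

lemma V_iff: "v \<in> \<V> \<longleftrightarrow> Poly_Mapping.keys v \<subseteq> \<W>"
  by (simp add: tensor_space_def)

lemma V_closed [simp]:
  "0 \<in> \<V>"
  "\<lbrakk>v \<in> \<V>; v' \<in> \<V>\<rbrakk> \<Longrightarrow> v + v' \<in> \<V>"
  "v \<in> \<V> \<Longrightarrow> scale c v \<in> \<V>"
  using keys_add[of v v'] keys_scale[of c v] unfolding V_iff by auto

lemma V_sum: "(\<And>a. a \<in> F \<Longrightarrow> f a \<in> \<V>) \<Longrightarrow> sum f F \<in> \<V>"
  by (induction F rule: infinite_finite_induct) simp_all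

lemma act_at_mem_V:
  assumes F: "F = T_op \<or> F = E_op" and i: "i \<in> {1..<n}" and v: "v \<in> \<V>"
  shows "act_at i F v \<in> \<V>"
proof -
  have basis: "act_at i F (bv w) \<in> \<V>" if w: "w \<in> \<W>" for w
  proof -
    have "i \<in> {1..<length w}"
      using i w by simp
    then obtain xs p q ys where w': "w = xs @ p # q # ys" and i': "i = Suc (length xs)"
      by (rule split_at_pair)
    have "bv (xs @ p # q # ys) \<in> \<V>" and "bv (xs @ q # p # ys) \<in> \<V>"
      using w unfolding w' V_iff by auto
    then show ?thesis
      using F unfolding w'
      by (elim disjE) (simp_all add: act_at_T_split[OF i'] act_at_E_split[OF i'] del: scale_single)
  qed
  have "act_at i F v
      = act_at i F (\<Sum>w\<in>Poly_Mapping.keys v. scale (Poly_Mapping.lookup v w) (bv w))"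
    by (simp only: sum_scaled_basis)
  also have "\<dots> = (\<Sum>w\<in>Poly_Mapping.keys v. scale (Poly_Mapping.lookup v w) (act_at i F (bv w)))"
    by (simp only: module_hom.sum[OF klinear_act_at] act_at_scale)
  also have "\<dots> \<in> \<V>"
    using v unfolding V_iff[of v] by (intro V_sum V_closed(3) basis) blast
  finally show ?thesis .
qed

lemma word_op_mem_V: "\<lbrakk>w \<in> lists \<G>; v \<in> \<V>\<rbrakk> \<Longrightarrow> word_op w v \<in> \<V>"
  by (induction w) (auto simp: act_at_mem_V \<G>_def)

interpretation F: linear_monoid_action "free_monoid \<G>" laurent_polys \<V> scale word_op
  by (intro linear_monoid_action.intro monoid_ring_of.intro monoid_free_monoid
      coefficient_ring_laurent_polys linear_monoid_action_axioms.intro)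
    (simp_all add: word_op_mem_V scale.scale_left_distrib scale.scale_right_distrib)

interpretation F: ring_action "bt_free_algebra n" \<V> F.ext
  unfolding bt_free_algebra_eq by (rule F.ring_action_ext)

lemma F_closed: "\<lbrakk>w \<in> lists \<G>; a \<in> laurent_polys\<rbrakk> \<Longrightarrow> Poly_Mapping.single w a \<in> carrier (bt_free_algebra n)"
  unfolding bt_free_algebra_eq by (rule F.single_mem) simp_all

lemma word_closed: "w \<in> lists \<G> \<Longrightarrow> bt_word w \<in> carrier (bt_free_algebra n)"
  using F_closed F.one_mem by blast

text \<open>A relation between words need only be checked on basis vectors of length \<open>n\<close>.\<close>

lemma word_relation_act:
  assumes "w \<in> lists \<G>" and "w' \<in> lists \<G>"
    and basis: "\<And>x. length x = n \<Longrightarrow> word_op w (bv x) = word_op w' (bv x)"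
  shows "bt_word w \<in> carrier (bt_free_algebra n) \<and> bt_word w' \<in> carrier (bt_free_algebra n)
    \<and> (\<forall>v\<in>\<V>. F.ext (bt_word w) v = F.ext (bt_word w') v)"
proof (intro conjI ballI word_closed assms)
  fix v assume "v \<in> \<V>"
  then have "word_op w v = word_op w' v"
    by (intro klinear_eqI[OF klinear_word_op klinear_word_op, of v \<W>]) (auto simp: V_iff basis)
  then show "F.ext (bt_word w) v = F.ext (bt_word w') v"
    by simp
qed

lemma relation_act:
  assumes "(x, y) \<in> bt_relations n"
  shows "x \<in> carrier (bt_free_algebra n) \<and> y \<in> carrier (bt_free_algebra n)
    \<and> (\<forall>v\<in>\<V>. F.ext x v = F.ext y v)"
  using assms
proof cases
  case (E1 i j)
  have "act_at i T_op (act_at j T_op (bv w)) = act_at j T_op (act_at i T_op (bv w))"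
    if "length w = n" for w
    using E1 that
      far_commute[OF _ _ _ klinear_act_at act_at_T_split klinear_act_at act_at_T_split, of i w j]
      far_commute[OF _ _ _ klinear_act_at act_at_T_split klinear_act_at act_at_T_split, of j w i]
    by (cases "i < j") auto
  then show ?thesis
    using E1(3-) unfolding E1(1,2) by (intro word_relation_act) auto
next
  case (E2 i j)
  then show ?thesis
    unfolding E2(1,2) by (intro word_relation_act) (auto intro: E_E_commute)
next
  case (E3 i j)
  \<comment> \<open>an \<open>E\<close> in the two-coefficient form required by \<open>far_commute\<close>\<close>
  have E: "act_at k E_op (bv (xs @ p # q # ys))
      = scale 0 (bv (xs @ q # p # ys)) + scale (\<delta> p q) (bv (xs @ p # q # ys))"
    if "k = Suc (length xs)" for k xs p q ys
    using act_at_E_split[OF that] by simp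
  have "act_at i E_op (act_at j T_op (bv w)) = act_at j T_op (act_at i E_op (bv w))"
    if "length w = n" for w
    using E3 that
      far_commute[OF _ _ _ klinear_act_at E klinear_act_at act_at_T_split, of i w j]
      far_commute[OF _ _ _ klinear_act_at act_at_T_split klinear_act_at E, of j w i]
    by (cases "i < j") auto
  then show ?thesis
    using E3(3-) unfolding E3(1,2) by (intro word_relation_act) auto
next
  case (E4 i)
  then show ?thesis
    unfolding E4(1,2) by (intro word_relation_act) (auto intro: E_idempotent)
next
  case (E5 i)
  then show ?thesis
    unfolding E5(1,2) by (intro word_relation_act) (auto intro: E_T_commute)
next
  case (E6 i j)
  then have "j = Suc i \<or> i = Suc j"
    by auto
  then have "act_at i T_op (act_at j T_op (act_at i T_op (bv w)))
      = act_at j T_op (act_at i T_op (act_at j T_op (bv w)))" if "length w = n" for w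
    using E6 that T_braid[of i w] T_braid[of j w] by auto
  then show ?thesis
    using E6(3-) unfolding E6(1,2) by (intro word_relation_act) auto
next
  case (E7 i j)
  then have "j = Suc i \<or> i = Suc j"
    by auto
  then have "act_at j E_op (act_at i T_op (act_at j T_op (bv w)))
      = act_at i T_op (act_at j T_op (act_at i E_op (bv w)))" if "length w = n" for w
    using E7 that neighbour_ties[of i w] neighbour_ties[of j w] by auto
  then show ?thesis
    using E7(3-) unfolding E7(1,2) by (intro word_relation_act) auto
next
  case (E8a i j)
  then have "j = Suc i \<or> i = Suc j"
    by auto
  then have "act_at i E_op (act_at j E_op (act_at j T_op (bv w)))
      = act_at i E_op (act_at j T_op (act_at i E_op (bv w)))" if "length w = n" for w
    using E8a that neighbour_ties[of i w] neighbour_ties[of j w] by auto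
  then show ?thesis
    using E8a(3-) unfolding E8a(1,2) by (intro word_relation_act) auto
next
  case (E8b i j)
  then have "j = Suc i \<or> i = Suc j"
    by auto
  then have "act_at i E_op (act_at j T_op (act_at i E_op (bv w)))
      = act_at j T_op (act_at i E_op (act_at j E_op (bv w)))" if "length w = n" for w
    using E8b that neighbour_ties[of i w] neighbour_ties[of j w] by auto
  then show ?thesis
    using E8b(3-) unfolding E8b(1,2) by (intro word_relation_act) auto
next
  case (E9 i)
  let ?T = "bt_word [TGen i]" and ?E = "bt_word [EGen i]" and ?c = "bt_const (indet - 1)"
  have closed: "?T \<in> carrier (bt_free_algebra n)" "?E \<in> carrier (bt_free_algebra n)"
    "bt_word [TGen i, TGen i] \<in> carrier (bt_free_algebra n)"
    "?c \<in> carrier (bt_free_algebra n)"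
    using E9 indet_minus_one_mem by (auto intro!: word_closed F_closed)
  have linear: "klinear (\<lambda>v. v + scale (indet - 1) (act_at i E_op (v + act_at i T_op v)))"
    by unfold_locales (simp_all add: expand ac_simps)
  have "word_op [TGen i, TGen i] v = v + scale (indet - 1) (act_at i E_op (v + act_at i T_op v))"
    if v: "v \<in> \<V>" for v
    by (rule klinear_eqI[OF klinear_word_op linear, of v \<W>])
      (use v E9(3) T_quadratic in \<open>auto simp: V_iff\<close>)
  then have "F.ext (bt_word [TGen i, TGen i]) v = F.ext y v" if "v \<in> \<V>" for v
    using that closed E9(3) by (simp add: E9(1,2) F.act_add F.act_mult F.act_one F.act_mem act_at_mem_V)
  then show ?thesis
    using closed by (simp add: E9(1,2))
qed

lemma bt_ideal: "ideal (bt_ideal n) (bt_free_algebra n)"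
  and bt_ideal_annihilates: "bt_ideal n \<subseteq> F.annihilator"
proof -
  have "{x \<ominus>\<^bsub>bt_free_algebra n\<^esub> y | x y. (x, y) \<in> bt_relations n} \<subseteq> F.annihilator"
    using relation_act by (auto simp: F.annihilator_def F.act_minus)
  then show "bt_ideal n \<subseteq> F.annihilator"
    unfolding bt_ideal_def by (rule F.genideal_minimal[OF F.annihilator_ideal])
  show "ideal (bt_ideal n) (bt_free_algebra n)"
    unfolding bt_ideal_def using relation_act by (intro F.genideal_ideal) auto
qed

abbreviation \<rho> :: "bt_free set \<Rightarrow> operator"
  where "\<rho> \<equiv> F.quotient_act"

lemma \<rho>_class: "\<lbrakk>x \<in> carrier (bt_free_algebra n); v \<in> \<V>\<rbrakk> \<Longrightarrow> \<rho> (bt_class n x) v = F.ext x v"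
  unfolding bt_class_def by (rule F.quotient_act_coset[OF bt_ideal bt_ideal_annihilates])

lemma bt_class_hom: "bt_class n \<in> ring_hom (bt_free_algebra n) (bt_integral n)"
proof -
  have "bt_class n = (\<lambda>x. bt_ideal n +>\<^bsub>bt_free_algebra n\<^esub> x)"
    by (simp add: bt_class_def fun_eq_iff)
  then show ?thesis
    using ideal.rcos_ring_hom[OF bt_ideal] by (simp add: bt_integral_def)
qed

lemma bt_integral_carrierE:
  assumes "X \<in> carrier (bt_integral n)"
  obtains x where "x \<in> carrier (bt_free_algebra n)" and "X = bt_class n x"
  using assms unfolding bt_integral_def FactRing_def A_RCOSETS_def' bt_class_def by auto

text \<open>All rational functions commute with the action of the integral form, not only the Laurent
  polynomials that it contains; this is why the action extends along the base change to
  the rational functions.\<close>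

lemma ext_scale: "x \<in> carrier (bt_free_algebra n) \<Longrightarrow> F.ext x (scale c v) = scale c (F.ext x v)"
  unfolding bt_free_algebra_eq
  by (induction rule: F.carrier_induct) (simp_all add: F.ext_add scale.scale_right_distrib mult.commute)

lemma const_central:
  assumes a: "a \<in> laurent_polys" and X: "X \<in> carrier (bt_integral n)"
  shows "bt_integral_scalar n a \<otimes>\<^bsub>bt_integral n\<^esub> X = X \<otimes>\<^bsub>bt_integral n\<^esub> bt_integral_scalar n a"
proof -
  obtain x where x: "x \<in> carrier (bt_free_algebra n)" "X = bt_class n x"
    using X by (rule bt_integral_carrierE)
  have c: "bt_const a \<in> carrier (bt_free_algebra n)"
    using a by (simp add: F_closed)
  have "bt_const a \<otimes>\<^bsub>bt_free_algebra n\<^esub> x = x \<otimes>\<^bsub>bt_free_algebra n\<^esub> bt_const a"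
    using x(1) unfolding bt_free_algebra_eq
    by (induction rule: F.carrier_induct)
      (simp_all add: conv_single_single conv_add_left conv_add_right mult.commute)
  then show ?thesis
    unfolding x(2) bt_integral_scalar_def
    using ring_hom_mult[OF bt_class_hom c x(1)] ring_hom_mult[OF bt_class_hom x(1) c] by simp
qed

interpretation compat: compatible_actions laurent_polys "bt_integral n" "bt_integral_scalar n"
  ratfun_field "\<lambda>a. a" \<V> \<rho> scale "\<lambda>k. scale (of_int k)"
proof -
  interpret C: cring ratfun_field by (rule cring_ratfun_field)
  interpret \<rho>: ring_action "bt_integral n" \<V> \<rho>
    unfolding bt_integral_def
    by (rule F.quotient_ring_action[OF bt_ideal bt_ideal_annihilates])
  have const: "bt_const a \<in> carrier (bt_free_algebra n)" if "a \<in> laurent_polys" for a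
    using that by (simp add: F_closed)
  show "compatible_actions laurent_polys (bt_integral n) (bt_integral_scalar n)
    ratfun_field (\<lambda>a. a) \<V> \<rho> scale (\<lambda>k. scale (of_int k))"
  proof unfold_locales
    fix X c v assume "X \<in> carrier (bt_integral n)" and v: "v \<in> \<V>"
    then obtain x where x: "x \<in> carrier (bt_free_algebra n)" "X = bt_class n x"
      by (metis bt_integral_carrierE)
    then show "\<rho> X (scale c v) = scale c (\<rho> X v)"
      using v by (simp add: \<rho>_class ext_scale)
  next
    show "\<rho> (bt_integral_scalar n a) v = scale a v" if "a \<in> laurent_polys" "v \<in> \<V>" for a v
      using that const by (simp add: bt_integral_scalar_def \<rho>_class)
  next
    show "bt_integral_scalar n a \<in> carrier (bt_integral n)" if "a \<in> laurent_polys" for a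
      unfolding bt_integral_scalar_def by (rule ring_hom_closed[OF bt_class_hom const[OF that]])
  qed (auto simp: const_central ratfun_field_def expand)
qed

lemma module_tensor_space: "module ratfun_field (tensor_space n)"
proof (rule moduleI[OF cring_ratfun_field])
  have add: "x \<oplus>\<^bsub>tensor_space n\<^esub> y = x + y" and zero: "\<zero>\<^bsub>tensor_space n\<^esub> = 0" for x y
    by (simp_all add: tensor_space_def)
  show "abelian_group (tensor_space n)"
  proof (rule abelian_groupI)
    fix x assume "x \<in> \<V>"
    then show "\<exists>y\<in>\<V>. y \<oplus>\<^bsub>tensor_space n\<^esub> x = \<zero>\<^bsub>tensor_space n\<^esub>"
      using V_closed(3)[of x "- 1"] by (intro bexI[of _ "scale (- 1) x"]) (simp_all add: add zero)
  qed (simp_all add: add zero ac_simps)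
qed (simp_all add: tensor_space_def ratfun_field_def expand V_closed(3)[unfolded tensor_space_def, simplified])

lemma tensor_space_module: 
  "algebra_module ratfun_field (bt_algebra n) (bt_scalar n) (tensor_space n) compat.pair.quotient_act"
proof -
  interpret K: cring ratfun_field by (rule cring_ratfun_field)
  interpret M: module ratfun_field "tensor_space n" by (rule module_tensor_space)
  interpret R: ring_action "bt_algebra n" \<V> compat.pair.quotient_act
    unfolding bt_algebra_def by (rule compat.tensor_ring_action)
  have scalar: "bt_scalar n = compat.tensor \<one>\<^bsub>bt_integral n\<^esub>"
    by (simp add: fun_eq_iff bt_scalar_def bt_tensor_def)
  have add: "x \<oplus>\<^bsub>tensor_space n\<^esub> y = x + y" for x y
    by (simp add: tensor_space_def)
  have smult: "c \<odot>\<^bsub>tensor_space n\<^esub> x = scale c x" for c x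
    by (simp add: tensor_space_def)
  show ?thesis
  proof unfold_locales
    show "bt_scalar n \<in> ring_hom ratfun_field (bt_algebra n)"
      unfolding scalar bt_algebra_def by (rule compat.scalar_hom)
    show "bt_scalar n k \<otimes>\<^bsub>bt_algebra n\<^esub> a = a \<otimes>\<^bsub>bt_algebra n\<^esub> bt_scalar n k"
      if "k \<in> carrier ratfun_field" "a \<in> carrier (bt_algebra n)" for k a
      using that unfolding scalar bt_algebra_def by (rule compat.scalar_central)
    show "compat.pair.quotient_act (bt_scalar n k) x = k \<odot>\<^bsub>tensor_space n\<^esub> x"
      if "k \<in> carrier ratfun_field" "x \<in> \<V>" for k x
      unfolding scalar smult using that
      by (simp add: compat.tensor_act compat.\<rho>.act_one)
  qed (simp_all add: add R.act_mem R.act_add R.act_add_vector R.act_mult R.act_one)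
qed

lemma gen_acts:
  assumes "g \<in> \<G>" and "v \<in> \<V>"
  shows "compat.pair.quotient_act (bt_tensor n (bt_class n (bt_word [g])) 1) v = gen_op g v"
proof -
  have g: "bt_word [g] \<in> carrier (bt_free_algebra n)"
    using assms(1) by (intro word_closed) simp
  have "(1 :: ratfun) \<in> carrier ratfun_field"
    by (simp add: ratfun_field_def)
  then have "compat.pair.quotient_act (bt_tensor n (bt_class n (bt_word [g])) 1) v
      = \<rho> (bt_class n (bt_word [g])) v"
    unfolding bt_tensor_def
    using assms(2) ring_hom_closed[OF bt_class_hom g] by (simp add: compat.tensor_act)
  then show ?thesis
    using assms(2) g by (simp add: \<rho>_class)
qed

lemma tensor_space_is_bt_module:
  "\<exists>act. algebra_module ratfun_field (bt_algebra n) (bt_scalar n) (tensor_space n) act \<and>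
    (\<forall>i\<in>{1..<n}. \<forall>x\<in>carrier (tensor_space n).
      act (bt_T n i) x = act_at i T_op x \<and> act (bt_E n i) x = act_at i E_op x)"
  using tensor_space_module gen_acts[of "TGen _"] gen_acts[of "EGen _"]
  unfolding bt_T_def bt_E_def by (intro exI[of _ compat.pair.quotient_act]) auto

end

theorem theorem1:
  fixes n :: nat
  assumes "n \<ge> 1"
  shows "\<exists>act. algebra_module ratfun_field (bt_algebra n) (bt_scalar n) (tensor_space n) act \<and>
    (\<forall>i\<in>{1..<n}. \<forall>x\<in>carrier (tensor_space n).
      act (bt_T n i) x = act_at i T_op x \<and> act (bt_E n i) x = act_at i E_op x)"
  by (rule tensor_space_is_bt_module)

end
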